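(* Let $d\ge1$ and let $\mu_0\in\Sigma_d$, where $\Sigma_d$ is the set of $\mu=(m_0,\dots,m_{2d-1})\in\mathbb{C}^{2d}$ such that $\det (m_{i+j})_{0\le i,j\le d-1}\neq 0$. Then for $\tilde\mu$ in a sufficiently small neighborhood of $\mu_0$, the solution $$\mathcal{PM}^{-1}(\tilde\mu)=\bigl(w(\tilde\mu),\ \{\beta_m(\tilde\mu)\}_{m=1}^{d}\bigr)$$ of the Prony problem with right-hand side $\tilde\mu$, expressed in the basis $\mathcal{B}(w)=\{\Delta_m(w)\}_{m=1}^d$ of finite differences, i.e. with $g=\sum_{m=1}^{d}\beta_m\,\Delta_m(w)$, is provided by continuous algebraic functions of $\tilde\mu$.
   Context: Configurations. For $w=(x_1,\dots,x_d)\in\mathbb{C}^d$ let $T(w)=(\tau_1,\dots,\tau_s)$ be its distinct coordinate values, listed in order of first appearance, and let $d_j$ be the number of times $\tau_j$ appears among $x_1,\dots,x_d$; so $\sum_j d_j=d$. The vector space $V_w$ consists of all linear combinations $g=\sum_{j=1}^{s}\sum_{\ell=0}^{d_j-1}\gamma_{j,\ell}\,\delta^{(\ell)}(x-\tau_j)$, $\gamma_{j,\ell}\in\mathbb{C}$; it has dimension $d$. The pairing convention used is $\int x^k\delta^{(\ell)}(x-\tau)\,dx=\frac{k!}{(k-\ell)!}\tau^{k-\ell}$ (read as $0$ if $\ell>k$). Prony mapping. $\mathcal{P}_d$ is the set of pairs $(w,g)$ with $w\in\mathbb{C}^d$, $g\in V_w$, and $\mathcal{PM}:\mathcal{P}_d\to\mathbb{C}^{2d}$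 is $\mathcal{PM}(w,g)=(m_0,\dots,m_{2d-1})$ with $m_k=\int x^k g(x)\,dx$. Solving the Prony problem with right-hand side $\mu$ means finding $(w,g)$ with $\mathcal{PM}(w,g)=\mu$. For $\mu\in\Sigma_d$ the solution exists and is unique up to a permutation of the coordinates of $w$. Finite differences. For $w=(x_1,\dots,x_d)$ and $1\le m\le d$, put $w_m=(x_1,\dots,x_m)$, let $\tau_{1,m},\dots,\tau_{s_m,m}$ be the distinct values among $x_1,\dots,x_m$ and $d_{1,m},\dots,d_{s_m,m}$ their multiplicities in $w_m$. Define $w^{(m)}_{j,\ell}$ by the partial fraction decomposition $$\prod_{j=1}^{s_m}\frac{1}{(z-\tau_{j,m})^{d_{j,m}}}=\sum_{j=1}^{s_m}\sum_{\ell=1}^{d_{j,m}}\frac{w^{(m)}_{j,\ell}}{(z-\tau_{j,m})^{\ell}}.$$ The $m$-th finite difference is $$\Delta_m(w)=\sum_{j=1}^{s_m}\sum_{\ell=1}^{d_{j,m}}\frac{w^{(m)}_{j,\ell}}{(\ell-1)!}\,\delta^{(\ell-1)}(x-\tau_{j,m})\in V_w .$$ For every $w\in\mathbb{C}^d$ the collection $\mathcal{B}(w)=\{\Delta_m(w)\}_{m=1}^d$ is a basis of $V_w$. Continuous algebraic functions. Since the coordinates of $w$ are determined only up to permutation (and may collide at $\mu_0$), the functions are understood as possibly multivalued: the finite set of all solutions $(w,\beta_1,\dots,\beta_d)\in\mathbb{C}^{2d}$, over all orderings of the nodes, depends continuously on $\tilde\mu$ (with respect to the Hausdorff distance), and each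 coordinate of a solution satisfies a nontrivial polynomial equation whose coefficients are polynomials in $\tilde\mu$. *)

theory Defs
  imports
    "HOL-Library.Poly_Mapping"
    "HOL-Analysis.L2_Norm"
    "Jordan_Normal_Form.Determinant"
begin

text \<open>
  Vectors of \<open>\<complex>\<^sup>n\<close> are complex lists of length \<open>n\<close>; the entry \<open>x\<^sub>i\<close> is \<open>w ! (i - 1)\<close>, whereas the
  moments \<open>m\<^sub>k\<close> are indexed from \<open>0\<close>, so that \<open>m\<^sub>k\<close> is \<open>\<mu> ! k\<close>.  The distinct entries of \<open>w\<close> are the
  elements of \<open>set w\<close>, and \<open>count_list w \<tau>\<close> is the multiplicity of \<open>\<tau>\<close>.
\<close>

definition vec_dist :: "complex list \<Rightarrow> complex list \<Rightarrow> real" where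
  "vec_dist x y = L2_set (\<lambda>i. dist (x ! i) (y ! i)) {..<length x}"

definition vec_ball :: "nat \<Rightarrow> complex list \<Rightarrow> real \<Rightarrow> complex list set" where
  "vec_ball n x r = {y. length y = n \<and> vec_dist x y < r}"

definition hausdorff_dist :: "complex list set \<Rightarrow> complex list set \<Rightarrow> real" where
  "hausdorff_dist A B =
     max (SUP a\<in>A. INF b\<in>B. vec_dist a b) (SUP b\<in>B. INF a\<in>A. vec_dist a b)"


text \<open>
  A finite linear combination of the (linearly independent) symbols \<open>\<delta>\<^sup>(\<^sup>l\<^sup>)(x - \<tau>)\<close> is the finitely
  supported family of its coefficients; \<open>Poly_Mapping.single (\<tau>, l) c\<close> is \<open>c \<delta>\<^sup>(\<^sup>l\<^sup>)(x - \<tau>)\<close>.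
\<close>

type_synonym delta_comb = "(complex \<times> nat) \<Rightarrow>\<^sub>0 complex"

definition scale_comb :: "complex \<Rightarrow> delta_comb \<Rightarrow> delta_comb" where
  "scale_comb c g = Poly_Mapping.map (\<lambda>a. c * a) g"

definition delta_moment :: "nat \<Rightarrow> complex \<times> nat \<Rightarrow> complex" where
  "delta_moment k = (\<lambda>(\<tau>, l). if l \<le> k then fact k / fact (k - l) * \<tau> ^ (k - l) else 0)"

definition moment :: "nat \<Rightarrow> delta_comb \<Rightarrow> complex" where
  "moment k g = (\<Sum>p\<in>Poly_Mapping.keys g. Poly_Mapping.lookup g p * delta_moment k p)"

definition V_space :: "complex list \<Rightarrow> delta_comb set" where
  "V_space w =
     {\<Sum>\<tau>\<in>set w. \<Sum>l<count_list w \<tau>. Poly_Mapping.single (\<tau>, l) (\<gamma> \<tau> l) | \<gamma>. True}"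

definition prony_domain :: "nat \<Rightarrow> (complex list \<times> delta_comb) set" where
  "prony_domain d = {(w, g). length w = d \<and> g \<in> V_space w}"

definition prony_map :: "nat \<Rightarrow> complex list \<times> delta_comb \<Rightarrow> complex list" where
  "prony_map d = (\<lambda>(w, g). map (\<lambda>k. moment k g) [0..<2 * d])"

definition hankel_regular :: "nat \<Rightarrow> complex list set" where
  "hankel_regular d =
     {\<mu>. length \<mu> = 2 * d \<and> Determinant.det (Matrix.mat d d (\<lambda>(i, j). \<mu> ! (i + j))) \<noteq> 0}"


text \<open>
  The value \<open>pf_coeff u \<tau> l\<close> is the coefficient of \<open>1 / (z - \<tau>)\<^sup>l\<close> in the partial fraction
  decomposition.  The coefficients are unique only for indices occurring in the decomposition; they
  are set to \<open>0\<close> elsewhere, which makes the description definite for nonempty \<open>u\<close>.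
\<close>

definition pf_coeff :: "complex list \<Rightarrow> complex \<Rightarrow> nat \<Rightarrow> complex" where
  "pf_coeff u = (THE c.
     (\<forall>\<tau> l. \<not> (\<tau> \<in> set u \<and> l \<in> {1..count_list u \<tau>}) \<longrightarrow> c \<tau> l = 0) \<and>
     (\<forall>z. z \<notin> set u \<longrightarrow>
        (\<Prod>\<tau>\<in>set u. 1 / (z - \<tau>) ^ count_list u \<tau>) =
        (\<Sum>\<tau>\<in>set u. \<Sum>l=1..count_list u \<tau>. c \<tau> l / (z - \<tau>) ^ l)))"

definition fin_diff :: "nat \<Rightarrow> complex list \<Rightarrow> delta_comb" where
  "fin_diff m w =
     (let u = take m w in
        \<Sum>\<tau>\<in>set u. \<Sum>l=1..count_list u \<tau>.
          Poly_Mapping.single (\<tau>, l - 1) (pf_coeff u \<tau> l / fact (l - 1)))"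


text \<open>
  All solutions of the Prony problem with right-hand side \<open>\<mu>\<close>, as vectors
  \<open>(x\<^sub>1, \<dots>, x\<^sub>d, \<beta>\<^sub>1, \<dots>, \<beta>\<^sub>d)\<close> in which every ordering of the nodes occurs.
\<close>

definition prony_solutions :: "nat \<Rightarrow> complex list \<Rightarrow> complex list set" where
  "prony_solutions d \<mu> =
     {w @ \<beta> | w \<beta> g.
        (w, g) \<in> prony_domain d \<and> prony_map d (w, g) = \<mu> \<and>
        length \<beta> = d \<and> g = (\<Sum>m=1..d. scale_comb (\<beta> ! (m - 1)) (fin_diff m w))}"


text \<open>
  Since \<open>\<complex>\<close> is infinite, polynomials in \<open>n\<close> variables can be identified with the functions on \<open>\<complex>\<^sup>n\<close>
  they induce; the definition is analogous to \<open>real_polynomial_function\<close>.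
\<close>

inductive coord_polynomial :: "nat \<Rightarrow> (complex list \<Rightarrow> complex) \<Rightarrow> bool" for n :: nat where
  const: "coord_polynomial n (\<lambda>\<mu>. a)"
| coord: "i < n \<Longrightarrow> coord_polynomial n (\<lambda>\<mu>. \<mu> ! i)"
| add: "coord_polynomial n p \<Longrightarrow> coord_polynomial n q \<Longrightarrow> coord_polynomial n (\<lambda>\<mu>. p \<mu> + q \<mu>)"
| mult: "coord_polynomial n p \<Longrightarrow> coord_polynomial n q \<Longrightarrow> coord_polynomial n (\<lambda>\<mu>. p \<mu> * q \<mu>)"

definition continuous_multivalued_on ::
  "complex list set \<Rightarrow> (complex list \<Rightarrow> complex list set) \<Rightarrow> bool" where
  "continuous_multivalued_on U F \<longleftrightarrow>
     (\<forall>\<mu>\<in>U. finite (F \<mu>) \<and> F \<mu> \<noteq> {}) \<and>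
     (\<forall>\<mu>\<in>U. \<forall>\<epsilon>>0. \<exists>\<eta>>0. \<forall>\<nu>\<in>U. vec_dist \<mu> \<nu> < \<eta> \<longrightarrow> hausdorff_dist (F \<mu>) (F \<nu>) < \<epsilon>)"

text \<open>
  Here \<open>U\<close> consists of vectors of length \<open>n\<close> and \<open>F\<close> takes values in vectors of length \<open>k\<close>.  The
  equation for a coordinate is the same on all of \<open>U\<close>, and nontriviality is required at every point
  of \<open>U\<close>: there the coefficients must not vanish simultaneously.
\<close>

definition algebraic_multivalued_on ::
  "nat \<Rightarrow> nat \<Rightarrow> complex list set \<Rightarrow> (complex list \<Rightarrow> complex list set) \<Rightarrow> bool" where
  "algebraic_multivalued_on n k U F \<longleftrightarrow>
     (\<forall>i<k. \<exists>N c. (\<forall>j\<le>N. coord_polynomial n (c j)) \<and>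
        (\<forall>\<mu>\<in>U. (\<exists>j\<le>N. c j \<mu> \<noteq> 0) \<and> (\<forall>s\<in>F \<mu>. (\<Sum>j\<le>N. c j \<mu> * (s ! i) ^ j) = 0)))"

end

theory Submission
  imports Defs "Jordan_Normal_Form.Char_Poly"
begin

text \<open>
  Pair \<open>g\<close> with polynomials by \<open>x\<^sup>k \<mapsto> m\<^sub>k\<close>.  The finite difference \<open>\<Delta>\<^sub>m(w)\<close> then acts as the divided
  difference at \<open>x\<^sub>1, \<dots>, x\<^sub>m\<close>, which makes \<open>\<Delta>\<^sub>1(w), \<dots>, \<Delta>\<^sub>d(w)\<close> dual to the Newton polynomials
  \<open>N\<^sub>j = (x - x\<^sub>1) \<cdots> (x - x\<^sub>j)\<close> for \<open>j < d\<close>, while every \<open>\<Delta>\<^sub>m(w)\<close> vanishes on the multiples of \<open>N\<^sub>d\<close>.  Since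
  \<open>N\<^sub>0, \<dots>, N\<^bsub>d-1\<^esub>, N\<^sub>d, x N\<^sub>d, \<dots>, x\<^bsup>d-1\<^esup> N\<^sub>d\<close> is a basis of the polynomials of degree below \<open>2d\<close>, the
  Prony problem for \<open>\<mu>\<close> splits in two parts (\<open>prony_solutions_iff_newton\<close>): the functional
  \<open>L\<^sub>\<mu>\<close> given by \<open>x\<^sup>k \<mapsto> \<mu>\<^sub>k\<close> must vanish on the \<open>x\<^sup>j N\<^sub>d\<close>, and \<open>\<beta>\<^bsub>j+1\<^esub> = L\<^sub>\<mu>(N\<^sub>j)\<close>.  The first part is a
  Hankel system for the coefficients of \<open>N\<^sub>d\<close>.  When the Hankel determinant \<open>D(\<mu>)\<close> is nonzero, Cramer's
  rule gives one solution, a monic polynomial \<open>Q\<^sub>\<mu>\<close> whose coefficients are polynomials in \<open>\<mu>\<close> divided by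
  \<open>D(\<mu>)\<close>.  Hence the solutions are exactly the vectors \<open>(w, L\<^sub>\<mu>(N\<^sub>0), \<dots>, L\<^sub>\<mu>(N\<^bsub>d-1\<^esub>))\<close>, where \<open>w\<close> lists the
  roots of \<open>Q\<^sub>\<mu>\<close> in any order (\<open>prony_solutions_eq\<close>).  Collisions of nodes do no harm in this
  description, and both assertions can be read off from it on any set where \<open>D\<close> has no zero.

  Continuity (\<open>prony_solutions_continuous\<close>).  The roots of a monic polynomial can be listed so that
  they converge when the coefficients do (\<open>roots_tendsto\<close>), and the numbers \<open>L\<^sub>\<mu>(N\<^sub>j)\<close> are polynomials in
  \<open>\<mu>\<close> and \<open>w\<close>.  All other orderings arise from one such listing by permutations, simultaneously at
  \<open>\<mu>\<close> and near \<open>\<mu>\<close>, and there are finitely many permutations.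

  Algebraicity (\<open>prony_solutions_algebraic\<close>).  By the equation \<open>Q\<^sub>\<mu>(x\<^sub>i) = 0\<close> the polynomials in the nodes form,
  over the polynomials in \<open>\<mu>\<close> with \<open>D\<close> inverted, a module generated by the finitely many monomials
  \<open>x\<^sub>1\<^bsup>\<alpha>\<^sub>1\<^esup> \<cdots> x\<^sub>d\<^bsup>\<alpha>\<^sub>d\<^esup>\<close> with all \<open>\<alpha>\<^sub>i < d\<close>.  Each coordinate of a solution acts on this module by multiplication,
  so it is an eigenvalue of a matrix whose entries are polynomials in \<open>\<mu>\<close> divided by a power of \<open>D\<close>, and
  the characteristic polynomial, cleared of denominators, is the required equation.
\<close>

section \<open>Partial fractions\<close>

text \<open>
  For nonempty \<open>u\<close> exactly one \<open>c\<close> has this property, namely \<open>pf_coeff u\<close>.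
\<close>

definition partial_fraction :: "complex list \<Rightarrow> (complex \<Rightarrow> nat \<Rightarrow> complex) \<Rightarrow> bool" where
  "partial_fraction u c \<longleftrightarrow>
     (\<forall>\<tau> l. \<not> (\<tau> \<in> set u \<and> l \<in> {1..count_list u \<tau>}) \<longrightarrow> c \<tau> l = 0) \<and>
     (\<forall>z. z \<notin> set u \<longrightarrow>
        (\<Prod>\<tau>\<in>set u. 1 / (z - \<tau>) ^ count_list u \<tau>) =
        (\<Sum>\<tau>\<in>set u. \<Sum>l=1..count_list u \<tau>. c \<tau> l / (z - \<tau>) ^ l))"

text \<open>
  If some coefficient at \<open>s\<close> is nonzero, let \<open>L\<close> be the order of the pole at \<open>s\<close>.  Multiplying by
  \<open>(z - s)\<^sup>L\<close> and letting \<open>z \<rightarrow> s\<close> isolates the leading coefficient, which must therefore vanish.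
\<close>

lemma vanishing_partial_fraction_imp_0:
  fixes e :: "complex \<Rightarrow> nat \<Rightarrow> complex"
  assumes fin: "finite S"
    and zero: "\<And>z. z \<notin> S \<Longrightarrow> (\<Sum>\<tau>\<in>S. \<Sum>l=1..n \<tau>. e \<tau> l / (z - \<tau>) ^ l) = 0"
    and s: "s \<in> S" and l: "l \<in> {1..n s}"
  shows "e s l = 0"
proof (rule ccontr)
  assume ne: "e s l \<noteq> 0"
  define L where "L = Max {k \<in> {1..n s}. e s k \<noteq> 0}"
  have finL: "finite {k \<in> {1..n s}. e s k \<noteq> 0}" by simp
  have Lin: "L \<in> {k \<in> {1..n s}. e s k \<noteq> 0}"
    unfolding L_def by (rule Max_in[OF finL]) (use ne l in auto)
  have Lmax: "e s k = 0" if "k \<in> {1..n s}" "L < k" for k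
    using Max_ge[OF finL, of k] that unfolding L_def[symmetric] by force
  \<comment> \<open>Only the term of order \<open>L\<close> at \<open>s\<close> survives in the limit: other poles stay bounded, lower orders
    keep a factor \<open>z - s\<close>, and higher orders are absent.\<close>
  let ?f = "\<lambda>z. \<Sum>\<tau>\<in>S. \<Sum>k=1..n \<tau>. e \<tau> k / (z - \<tau>) ^ k * (z - s) ^ L"
  have summand_lim: "((\<lambda>z. e \<tau> k / (z - \<tau>) ^ k * (z - s) ^ L) \<longlongrightarrow>
      (if \<tau> = s \<and> k = L then e s L else 0)) (at s)" if "\<tau> \<in> S" "k \<in> {1..n \<tau>}" for \<tau> k
  proof (cases "\<tau> = s")
    case False
    have "((\<lambda>z. e \<tau> k / (z - \<tau>) ^ k * (z - s) ^ L) \<longlongrightarrow>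
        e \<tau> k / (s - \<tau>) ^ k * (s - s) ^ L) (at s)"
      using False by (intro tendsto_intros) auto
    then show ?thesis using False Lin by (auto simp: power_0_left)
  next
    case True
    consider "k < L" | "k = L" | "L < k" by linarith
    then show ?thesis
    proof cases
      case 1
      have "((\<lambda>z. e s k * (z - s) ^ (L - k)) \<longlongrightarrow> e s k * (s - s) ^ (L - k)) (at s)"
        by (intro tendsto_intros)
      moreover have "\<forall>\<^sub>F z in at s. e s k * (z - s) ^ (L - k) = e s k / (z - s) ^ k * (z - s) ^ L"
        unfolding eventually_at_filter
      proof (rule always_eventually, intro allI impI)
        fix z :: complex assume "z \<noteq> s"
        then show "e s k * (z - s) ^ (L - k) = e s k / (z - s) ^ k * (z - s) ^ L"
          using 1 by (simp add: power_diff)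
      qed
      ultimately have "((\<lambda>z. e s k / (z - s) ^ k * (z - s) ^ L) \<longlongrightarrow> e s k * (s - s) ^ (L - k)) (at s)"
        by (rule Lim_transform_eventually)
      then show ?thesis using 1 True by (simp add: power_0_left)
    next
      case 2
      have "\<forall>\<^sub>F z in at s. e s L = e s k / (z - s) ^ k * (z - s) ^ L"
        unfolding eventually_at_filter using 2 by (auto intro!: always_eventually)
      then have "((\<lambda>z. e s k / (z - s) ^ k * (z - s) ^ L) \<longlongrightarrow> e s L) (at s)"
        by (rule Lim_transform_eventually[OF tendsto_const])
      then show ?thesis using 2 True by simp
    next
      case 3
      then show ?thesis using Lmax that True by simp
    qed
  qed
  have "(?f \<longlongrightarrow> (\<Sum>\<tau>\<in>S. \<Sum>k=1..n \<tau>. if \<tau> = s \<and> k = L then e s L else 0)) (at s)"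
    by (intro tendsto_sum summand_lim)
  also have "(\<Sum>\<tau>\<in>S. \<Sum>k=1..n \<tau>. if \<tau> = s \<and> k = L then e s L else 0)
      = (\<Sum>\<tau>\<in>S. if \<tau> = s then (\<Sum>k=1..n s. if k = L then e s L else 0) else 0)"
    by (intro sum.cong) auto
  also have "\<dots> = e s L" using s fin Lin by (simp add: sum.delta)
  finally have lim: "(?f \<longlongrightarrow> e s L) (at s)" .
  have "\<forall>\<^sub>F z in at s. \<forall>\<tau>\<in>S. z \<noteq> \<tau>"
    using fin by (intro eventually_ball_finite ballI eventually_neq_at_within)
  then have "\<forall>\<^sub>F z in at s. 0 = ?f z"
  proof (rule eventually_mono)
    fix z assume "\<forall>\<tau>\<in>S. z \<noteq> \<tau>"
    then have "z \<notin> S" by blast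
    then have "(\<Sum>\<tau>\<in>S. \<Sum>k=1..n \<tau>. e \<tau> k / (z - \<tau>) ^ k) * (z - s) ^ L = 0" using zero by simp
    then show "0 = ?f z" by (simp add: sum_distrib_right)
  qed
  then have "(?f \<longlongrightarrow> 0) (at s)" by (rule Lim_transform_eventually[OF tendsto_const])
  with lim have "e s L = 0" using LIM_unique by blast
  then show False using Lin by simp
qed

lemma partial_fraction_unique:
  assumes c: "partial_fraction u c" and c': "partial_fraction u c'"
  shows "c = c'"
proof (intro ext)
  fix s l
  show "c s l = c' s l"
  proof (cases "s \<in> set u \<and> l \<in> {1..count_list u s}")
    case False
    then show ?thesis using c c' unfolding partial_fraction_def by metis
  next
    case True
    have "c s l - c' s l = 0"
    proof (rule vanishing_partial_fraction_imp_0[where S = "set u" and n = "count_list u"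
          and e = "\<lambda>\<tau> l. c \<tau> l - c' \<tau> l"])
      fix z assume "z \<notin> set u"
      then have "(\<Sum>\<tau>\<in>set u. \<Sum>l=1..count_list u \<tau>. c \<tau> l / (z - \<tau>) ^ l)
          = (\<Sum>\<tau>\<in>set u. \<Sum>l=1..count_list u \<tau>. c' \<tau> l / (z - \<tau>) ^ l)"
        using trans[OF sym[OF c[unfolded partial_fraction_def, THEN conjunct2, rule_format]]
            c'[unfolded partial_fraction_def, THEN conjunct2, rule_format]] by blast
      then show "(\<Sum>\<tau>\<in>set u. \<Sum>l=1..count_list u \<tau>. (c \<tau> l - c' \<tau> l) / (z - \<tau>) ^ l) = 0"
        by (simp add: diff_divide_distrib sum_subtractf)
    qed (use True in auto)
    then show ?thesis by simp
  qed
qed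

lemma pf_coeff_eqI:
  assumes "partial_fraction u c"
  shows "pf_coeff u = c"
proof -
  have "pf_coeff u = (THE c. partial_fraction u c)"
    unfolding pf_coeff_def partial_fraction_def ..
  also have "\<dots> = c"
    by (rule the_equality[of "partial_fraction u", OF assms]) (rule partial_fraction_unique[OF _ assms])
  finally show ?thesis .
qed

text \<open>
  Coefficients of different node lists live on different index ranges; extending both by zero to
  one common rectangle is what allows their sums to be compared term by term.
\<close>

lemma sum_over_support:
  fixes c :: "complex \<Rightarrow> nat \<Rightarrow> complex"
  assumes supp: "\<And>\<tau> l. \<not> (\<tau> \<in> set u \<and> l \<in> {1..count_list u \<tau>}) \<Longrightarrow> c \<tau> l = 0"
    and S: "finite S" "set u \<subseteq> S" and N: "length u \<le> N"
  shows "(\<Sum>\<tau>\<in>set u. \<Sum>l=1..count_list u \<tau>. c \<tau> l * h \<tau> l) = (\<Sum>\<tau>\<in>S. \<Sum>l=1..N. c \<tau> l * h \<tau> l)"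
proof -
  have "(\<Sum>\<tau>\<in>set u. \<Sum>l=1..count_list u \<tau>. c \<tau> l * h \<tau> l) = (\<Sum>\<tau>\<in>set u. \<Sum>l=1..N. c \<tau> l * h \<tau> l)"
  proof (rule sum.cong[OF refl])
    fix \<tau>
    have "{1..count_list u \<tau>} \<subseteq> {1..N}" using count_le_length[of u \<tau>] N by auto
    then show "(\<Sum>l=1..count_list u \<tau>. c \<tau> l * h \<tau> l) = (\<Sum>l=1..N. c \<tau> l * h \<tau> l)"
      by (rule sum.mono_neutral_left[rotated]) (use supp in auto)
  qed
  also have "\<dots> = (\<Sum>\<tau>\<in>S. \<Sum>l=1..N. c \<tau> l * h \<tau> l)"
    by (rule sum.mono_neutral_left) (use S supp in auto)
  finally show ?thesis .
qed

lemma prod_multiplicities_eq_prod_list: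
  fixes f :: "'a \<Rightarrow> 'b :: comm_monoid_mult"
  assumes "finite S" "set u \<subseteq> S"
  shows "(\<Prod>\<tau>\<in>S. f \<tau> ^ count_list u \<tau>) = prod_list (map f u)"
  using assms
proof (induction u)
  case (Cons a u)
  have "(\<Prod>\<tau>\<in>S. f \<tau> ^ count_list (a # u) \<tau>)
      = (\<Prod>\<tau>\<in>S. f \<tau> ^ count_list u \<tau> * (if \<tau> = a then f a else 1))"
    by (intro prod.cong) (auto simp: mult.commute)
  also have "\<dots> = prod_list (map f u) * f a"
    using Cons by (simp add: prod.distrib prod.delta)
  finally show ?case by (simp add: mult.commute)
qed simp

lemma partial_fraction_iff:
  "partial_fraction u c \<longleftrightarrow>
     (\<forall>\<tau> l. \<not> (\<tau> \<in> set u \<and> l \<in> {1..count_list u \<tau>}) \<longrightarrow> c \<tau> l = 0) \<and>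
     (\<forall>z. z \<notin> set u \<longrightarrow>
        prod_list (map (\<lambda>x. 1 / (z - x)) u) =
        (\<Sum>\<tau>\<in>set u. \<Sum>l=1..count_list u \<tau>. c \<tau> l * (1 / (z - \<tau>) ^ l)))"
proof -
  have "(\<Prod>\<tau>\<in>set u. 1 / (z - \<tau>) ^ count_list u \<tau>) = prod_list (map (\<lambda>x. 1 / (z - x)) u)" for z
    using prod_multiplicities_eq_prod_list[of "set u" u "\<lambda>x. 1 / (z - x)"]
    by (simp add: power_one_over)
  then show ?thesis unfolding partial_fraction_def by simp
qed

text \<open>
  Multiplication by \<open>z - x\<close> sends \<open>h\<^sub>l = 1 / (z - \<tau>)\<^sup>l\<close> to \<open>(\<tau> - x) h\<^sub>l + h\<^bsub>l-1\<^esub>\<close>, and it acts in the same way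
  on Taylor coefficients of order \<open>l - 1\<close> at \<open>\<tau>\<close>.  Summation by parts moves this action to the
  coefficients; the boundary term is \<open>C\<^sub>1 h\<^sub>0\<close>.
\<close>

lemma multiply_by_node:
  fixes C :: "nat \<Rightarrow> 'a :: comm_ring_1"
  assumes g: "\<And>l. l \<in> {1..N} \<Longrightarrow> g l = r * h l + h (l - 1)"
    and c: "\<And>l. l \<in> {1..N} \<Longrightarrow> c l = r * C l + C (Suc l)" and top: "C (Suc N) = 0"
  shows "(\<Sum>l=1..N. C l * g l) = C 1 * h 0 + (\<Sum>l=1..N. c l * h l)"
proof -
  have shift: "(\<Sum>l=1..N. C l * h (l - 1)) + C (Suc N) * h N
      = C 1 * h 0 + (\<Sum>l=1..N. C (Suc l) * h l)" for N
    by (induction N) (auto simp: algebra_simps)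
  have "(\<Sum>l=1..N. C l * g l) = (\<Sum>l=1..N. r * C l * h l) + (\<Sum>l=1..N. C l * h (l - 1))"
    by (simp add: g sum.distrib[symmetric] algebra_simps)
  also have "\<dots> = C 1 * h 0 + (\<Sum>l=1..N. (r * C l + C (Suc l)) * h l)"
    using shift[of N] top by (simp add: sum.distrib algebra_simps)
  finally show ?thesis by (simp add: c)
qed

lemma partial_fraction_singleton:
  "partial_fraction [x] (\<lambda>\<tau> l. if \<tau> = x \<and> l = 1 then 1 else 0)"
  unfolding partial_fraction_iff by auto

text \<open>
  Appending a node \<open>x\<close> divides the rational function by \<open>z - x\<close>, so the new coefficients \<open>C\<close> have to turn
  into \<open>c\<close> under multiplication by \<open>z - x\<close>.  The recurrence and the vanishing of the constant term
  express this.  For \<open>\<tau> \<noteq> x\<close> the recurrence is solved downwards from the highest order (\<open>E\<close> below);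
  at \<open>\<tau> = x\<close> it shifts the orders by one, and \<open>C x 1\<close> is left to kill the constant term.
\<close>

lemma partial_fraction_snoc:
  assumes c: "partial_fraction u c"
  obtains C where "partial_fraction (u @ [x]) C"
    and "\<And>\<tau> l. 1 \<le> l \<Longrightarrow> c \<tau> l = (\<tau> - x) * C \<tau> l + C \<tau> (Suc l)"
    and "(\<Sum>\<tau>\<in>set (u @ [x]). C \<tau> 1) = 0"
proof -
  have supp: "c \<tau> l = 0" if "\<not> (\<tau> \<in> set u \<and> l \<in> {1..count_list u \<tau>})" for \<tau> l
    using c that unfolding partial_fraction_def by blast
  define E where "E \<tau> l = (\<Sum>j=l..count_list u \<tau>. c \<tau> j / (x - \<tau>) ^ Suc (j - l))" for \<tau> l
  define C where "C \<tau> l = (if l = 0 then 0 else if \<tau> \<noteq> x then - E \<tau> l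
      else if l = 1 then (\<Sum>\<sigma>\<in>set u - {x}. E \<sigma> 1) else c x (l - 1))" for \<tau> l
  have rec: "c \<tau> l = (\<tau> - x) * C \<tau> l + C \<tau> (Suc l)" if l: "1 \<le> l" for \<tau> l
  proof (cases "\<tau> = x")
    case True
    then show ?thesis using l by (simp add: C_def)
  next
    case False
    have "(x - \<tau>) * E \<tau> l = c \<tau> l + E \<tau> (Suc l)"
    proof (cases "l \<le> count_list u \<tau>")
      case True
      have "(x - \<tau>) * (c \<tau> j / (x - \<tau>) ^ Suc (j - l)) = c \<tau> j / (x - \<tau>) ^ (j - l)" for j
        using False by simp
      then have "(x - \<tau>) * E \<tau> l = (\<Sum>j=l..count_list u \<tau>. c \<tau> j / (x - \<tau>) ^ (j - l))"
        unfolding E_def sum_distrib_left by simp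
      also have "\<dots> = c \<tau> l + (\<Sum>j=Suc l..count_list u \<tau>. c \<tau> j / (x - \<tau>) ^ (j - l))"
        using True by (subst sum.atLeast_Suc_atMost) auto
      also have "(\<Sum>j=Suc l..count_list u \<tau>. c \<tau> j / (x - \<tau>) ^ (j - l)) = E \<tau> (Suc l)"
        unfolding E_def by (intro sum.cong) (auto simp: Suc_diff_Suc)
      finally show ?thesis .
    next
      case beyond: False
      then show ?thesis using supp[of \<tau> l] by (simp add: E_def)
    qed
    then show ?thesis using False l by (simp add: C_def algebra_simps)
  qed
  have suppC: "C \<tau> l = 0"
    if out: "\<not> (\<tau> \<in> set (u @ [x]) \<and> l \<in> {1..count_list (u @ [x]) \<tau>})" for \<tau> l
  proof (cases "\<tau> = x")
    case True
    then have "l = 0 \<or> (l \<ge> 2 \<and> l - 1 > count_list u x)"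
      using out by auto
    then show ?thesis using supp[of x "l - 1"] True by (auto simp: C_def)
  next
    case False
    then have "l = 0 \<or> count_list u \<tau> < l" using out
      by (cases "\<tau> \<in> set u") (auto simp: count_list_0_iff)
    then show ?thesis using False by (auto simp: C_def E_def)
  qed
  have sum1: "(\<Sum>\<tau>\<in>set (u @ [x]). C \<tau> 1) = 0"
  proof -
    have "(\<Sum>\<tau>\<in>set (u @ [x]). C \<tau> 1) = C x 1 + (\<Sum>\<tau>\<in>set u - {x}. C \<tau> 1)"
      by (simp add: sum.insert_remove)
    also have "(\<Sum>\<tau>\<in>set u - {x}. C \<tau> 1) = - (\<Sum>\<tau>\<in>set u - {x}. E \<tau> 1)"
      by (auto simp: C_def sum_negf[symmetric] intro!: sum.cong)
    finally show ?thesis by (simp add: C_def)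
  qed
  have "partial_fraction (u @ [x]) C"
    unfolding partial_fraction_iff
  proof (intro conjI allI impI)
    fix z assume z: "z \<notin> set (u @ [x])"
    let ?S = "set (u @ [x])" and ?N = "length (u @ [x])"
    have top: "C \<tau> (Suc ?N) = 0" for \<tau>
      by (rule suppC) (use count_le_length[of "u @ [x]" \<tau>] in auto)
    have step: "(\<Sum>l=1..?N. C \<tau> l * ((z - x) * (1 / (z - \<tau>) ^ l)))
        = C \<tau> 1 * (1 / (z - \<tau>) ^ 0) + (\<Sum>l=1..?N. c \<tau> l * (1 / (z - \<tau>) ^ l))" if "\<tau> \<in> ?S" for \<tau>
    proof (rule multiply_by_node[where r = "\<tau> - x"])
      fix l assume "l \<in> {1..?N}"
      moreover have "z \<noteq> \<tau>" using z that by auto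
      ultimately show "(z - x) * (1 / (z - \<tau>) ^ l) = (\<tau> - x) * (1 / (z - \<tau>) ^ l) + 1 / (z - \<tau>) ^ (l - 1)"
        by (cases l) (auto simp: field_simps)
    qed (use rec top in auto)
    have "(z - x) * (\<Sum>\<tau>\<in>?S. \<Sum>l=1..?N. C \<tau> l * (1 / (z - \<tau>) ^ l))
        = (\<Sum>\<tau>\<in>?S. \<Sum>l=1..?N. C \<tau> l * ((z - x) * (1 / (z - \<tau>) ^ l)))"
      by (simp only: sum_distrib_left mult.left_commute)
    also have "\<dots> = (\<Sum>\<tau>\<in>?S. C \<tau> 1 * (1 / (z - \<tau>) ^ 0) + (\<Sum>l=1..?N. c \<tau> l * (1 / (z - \<tau>) ^ l)))"
      by (rule sum.cong[OF refl step])
    also have "\<dots> = (\<Sum>\<tau>\<in>?S. \<Sum>l=1..?N. c \<tau> l * (1 / (z - \<tau>) ^ l))"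
      using sum1 by (simp add: sum.distrib)
    also have "\<dots> = (\<Sum>\<tau>\<in>set u. \<Sum>l=1..count_list u \<tau>. c \<tau> l * (1 / (z - \<tau>) ^ l))"
      by (rule sum_over_support[symmetric]) (use supp in auto)
    also have "\<dots> = prod_list (map (\<lambda>x. 1 / (z - x)) u)"
      using c z unfolding partial_fraction_iff by auto
    finally have "(\<Sum>\<tau>\<in>?S. \<Sum>l=1..?N. C \<tau> l * (1 / (z - \<tau>) ^ l))
        = prod_list (map (\<lambda>x. 1 / (z - x)) (u @ [x]))"
      using z by (simp add: field_simps)
    moreover have "(\<Sum>\<tau>\<in>?S. \<Sum>l=1..count_list (u @ [x]) \<tau>. C \<tau> l * (1 / (z - \<tau>) ^ l))
        = (\<Sum>\<tau>\<in>?S. \<Sum>l=1..?N. C \<tau> l * (1 / (z - \<tau>) ^ l))"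
      by (rule sum_over_support[OF suppC]) auto
    ultimately show "prod_list (map (\<lambda>x. 1 / (z - x)) (u @ [x]))
        = (\<Sum>\<tau>\<in>?S. \<Sum>l=1..count_list (u @ [x]) \<tau>. C \<tau> l * (1 / (z - \<tau>) ^ l))" by simp
  qed (use suppC in blast)
  then show ?thesis using that rec sum1 by blast
qed

lemma partial_fraction_exists: "u \<noteq> [] \<Longrightarrow> \<exists>c. partial_fraction u c"
proof (induction u rule: rev_induct)
  case (snoc x u)
  show ?case
  proof (cases "u = []")
    case True
    then show ?thesis using partial_fraction_singleton[of x] by auto
  next
    case False
    then show ?thesis using snoc.IH partial_fraction_snoc by blast
  qed
qed simp

lemma partial_fraction_pf_coeff:
  assumes "u \<noteq> []"
  shows "partial_fraction u (pf_coeff u)"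
  using partial_fraction_exists[OF assms] pf_coeff_eqI by blast

text \<open>
  The relation between consecutive finite differences; together with the case of a single node it
  determines all their moments.
\<close>

lemma pf_coeff_snoc:
  assumes "u \<noteq> []"
  shows "1 \<le> l \<Longrightarrow> pf_coeff u \<tau> l = (\<tau> - x) * pf_coeff (u @ [x]) \<tau> l + pf_coeff (u @ [x]) \<tau> (Suc l)"
    and "(\<Sum>\<tau>\<in>set (u @ [x]). pf_coeff (u @ [x]) \<tau> 1) = 0"
proof -
  obtain C where C: "partial_fraction (u @ [x]) C"
    "\<And>\<tau> l. 1 \<le> l \<Longrightarrow> pf_coeff u \<tau> l = (\<tau> - x) * C \<tau> l + C \<tau> (Suc l)"
    "(\<Sum>\<tau>\<in>set (u @ [x]). C \<tau> 1) = 0"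
    using partial_fraction_snoc[OF partial_fraction_pf_coeff[OF assms], of x] by metis
  note eq = pf_coeff_eqI[OF C(1)]
  show "1 \<le> l \<Longrightarrow> pf_coeff u \<tau> l = (\<tau> - x) * pf_coeff (u @ [x]) \<tau> l + pf_coeff (u @ [x]) \<tau> (Suc l)"
    and "(\<Sum>\<tau>\<in>set (u @ [x]). pf_coeff (u @ [x]) \<tau> 1) = 0"
    unfolding eq using C by blast+
qed

lemma pf_coeff_eq_0:
  "u \<noteq> [] \<Longrightarrow> \<not> (\<tau> \<in> set u \<and> l \<in> {1..count_list u \<tau>}) \<Longrightarrow> pf_coeff u \<tau> l = 0"
  using partial_fraction_pf_coeff unfolding partial_fraction_def by blast

section \<open>Moments of finite differences\<close>

lemma moment_eq_sum_superset:
  assumes "finite A" "Poly_Mapping.keys g \<subseteq> A"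
  shows "moment k g = (\<Sum>p\<in>A. Poly_Mapping.lookup g p * delta_moment k p)"
  unfolding moment_def using assms
  by (intro sum.mono_neutral_left) (auto simp: Poly_Mapping.in_keys_iff)

lemma moment_0 [simp]: "moment k 0 = 0"
  by (simp add: moment_def)

lemma moment_add: "moment k (f + g) = moment k f + moment k g"
proof -
  let ?A = "Poly_Mapping.keys f \<union> Poly_Mapping.keys g"
  have "Poly_Mapping.keys (f + g) \<subseteq> ?A" by (rule Poly_Mapping.keys_add)
  then show ?thesis
    using moment_eq_sum_superset[of ?A "f + g" k] moment_eq_sum_superset[of ?A f k]
      moment_eq_sum_superset[of ?A g k]
    by (simp add: Poly_Mapping.lookup_add sum.distrib algebra_simps)
qed

lemma moment_sum: "moment k (\<Sum>i\<in>I. f i) = (\<Sum>i\<in>I. moment k (f i))"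
  by (induction I rule: infinite_finite_induct) (auto simp: moment_add)

lemma lookup_scale_comb: "Poly_Mapping.lookup (scale_comb c g) p = c * Poly_Mapping.lookup g p"
  by (simp add: scale_comb_def Poly_Mapping.map.rep_eq when_def)

lemma moment_scale: "moment k (scale_comb c g) = c * moment k g"
proof -
  have "Poly_Mapping.keys (scale_comb c g) \<subseteq> Poly_Mapping.keys g"
    by (auto simp: Poly_Mapping.in_keys_iff lookup_scale_comb)
  then have "moment k (scale_comb c g)
      = (\<Sum>p\<in>Poly_Mapping.keys g. Poly_Mapping.lookup (scale_comb c g) p * delta_moment k p)"
    by (intro moment_eq_sum_superset) auto
  then show ?thesis
    by (simp add: lookup_scale_comb moment_def sum_distrib_left mult.assoc)
qed

lemma moment_single: "moment k (Poly_Mapping.single p a) = a * delta_moment k p"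
  by (subst moment_eq_sum_superset[of "{p}"]) auto

text \<open>
  The \<open>(l - 1)\<close>-st Taylor coefficient of \<open>x\<^sup>k\<close> at \<open>\<tau>\<close>, with the shift by one that pairs it with
  \<open>1 / (z - \<tau>)\<^sup>l\<close>.  With the value \<open>0\<close> at \<open>l = 0\<close> the boundary term of \<open>multiply_by_node\<close> disappears.
\<close>

definition taylor_moment :: "nat \<Rightarrow> complex \<Rightarrow> nat \<Rightarrow> complex" where
  "taylor_moment k \<tau> l = (if l = 0 then 0 else delta_moment k (\<tau>, l - 1) / fact (l - 1))"

lemma delta_moment_binomial:
  "delta_moment k (\<tau>, l) / fact l = of_nat (k choose l) * \<tau> ^ (k - l)"
  by (auto simp: delta_moment_def binomial_fact binomial_eq_0)

lemma taylor_moment_binomial: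
  "taylor_moment k \<tau> (Suc l) = of_nat (k choose l) * \<tau> ^ (k - l)"
  using delta_moment_binomial[of k \<tau> l] by (simp add: taylor_moment_def)

text \<open>
  Expand \<open>x \<cdot> x\<^sup>k = (\<tau> + (x - \<tau>)) x\<^sup>k\<close> at \<open>\<tau>\<close>.
\<close>

lemma taylor_moment_Suc:
  assumes "1 \<le> l"
  shows "taylor_moment (Suc k) \<tau> l = \<tau> * taylor_moment k \<tau> l + taylor_moment k \<tau> (l - 1)"
proof -
  obtain i where i: "l = Suc i" using assms by (cases l) auto
  show ?thesis
  proof (cases i)
    case 0
    then show ?thesis using i by (simp add: taylor_moment_binomial taylor_moment_def[of _ _ 0])
  next
    case (Suc j)
    have "of_nat (Suc k choose i) * \<tau> ^ (Suc k - i)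
        = \<tau> * (of_nat (k choose i) * \<tau> ^ (k - i)) + of_nat (k choose j) * \<tau> ^ (k - j)"
    proof (cases "i \<le> k")
      case True
      then have "\<tau> ^ (k - j) = \<tau> * \<tau> ^ (k - i)"
        using Suc by (metis Suc_diff_Suc Suc_le_lessD power_Suc)
      then show ?thesis using Suc by (simp add: algebra_simps)
    next
      case False
      then show ?thesis using Suc by (simp add: binomial_eq_0)
    qed
    then show ?thesis using i Suc by (simp only: taylor_moment_binomial diff_Suc_1)
  qed
qed

lemma moment_fin_diff:
  "moment k (fin_diff m w) = (\<Sum>\<tau>\<in>set (take m w). \<Sum>l=1..count_list (take m w) \<tau>.
     pf_coeff (take m w) \<tau> l * taylor_moment k \<tau> l)"
  unfolding fin_diff_def Let_def moment_sum moment_single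
  by (intro sum.cong) (auto simp: taylor_moment_def)

lemma moment_fin_diff_1:
  assumes "w \<noteq> []"
  shows "moment k (fin_diff 1 w) = (w ! 0) ^ k"
proof -
  have u: "take 1 w = [w ! 0]" using assms by (cases w) auto
  show ?thesis
    unfolding moment_fin_diff u pf_coeff_eqI[OF partial_fraction_singleton]
    by (simp add: taylor_moment_def delta_moment_def)
qed

text \<open>
  The second equation says \<open>\<Delta>\<^bsub>m+1\<^esub>((x - x\<^bsub>m+1\<^esub>) p) = \<Delta>\<^sub>m(p)\<close>, the defining property of divided differences.
  It is the recurrence of \<open>pf_coeff_snoc\<close>, transported to the moments by \<open>multiply_by_node\<close>.
\<close>

lemma moment_fin_diff_Suc:
  assumes m: "1 \<le> m" "m < length w"
  shows "moment 0 (fin_diff (Suc m) w) = 0"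
    and "moment (Suc k) (fin_diff (Suc m) w)
      = w ! m * moment k (fin_diff (Suc m) w) + moment k (fin_diff m w)"
proof -
  define u where "u = take m w"
  define x where "x = w ! m"
  have u': "take (Suc m) w = u @ [x]"
    using m by (simp add: u_def x_def take_Suc_conv_app_nth)
  have ne: "u \<noteq> []" using m by (auto simp: u_def)
  let ?C = "pf_coeff (u @ [x])" and ?c = "pf_coeff u"
  let ?S = "set (u @ [x])" and ?N = "length (u @ [x])"
  have mom': "moment k (fin_diff (Suc m) w) = (\<Sum>\<tau>\<in>?S. \<Sum>l=1..?N. ?C \<tau> l * taylor_moment k \<tau> l)" for k
    unfolding moment_fin_diff u' by (rule sum_over_support) (use pf_coeff_eq_0[of "u @ [x]"] in auto)
  have mom: "moment k (fin_diff m w) = (\<Sum>\<tau>\<in>?S. \<Sum>l=1..?N. ?c \<tau> l * taylor_moment k \<tau> l)" for k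
    unfolding moment_fin_diff u_def[symmetric]
    by (rule sum_over_support) (use pf_coeff_eq_0[OF ne] in auto)
  have top: "?C \<tau> (Suc ?N) = 0" for \<tau>
    by (rule pf_coeff_eq_0) (use count_le_length[of "u @ [x]" \<tau>] in auto)
  have "(\<Sum>l=1..?N. ?C \<tau> l * taylor_moment 0 \<tau> l) = ?C \<tau> 1" for \<tau>
  proof -
    have "(\<Sum>l=1..?N. ?C \<tau> l * taylor_moment 0 \<tau> l) = (\<Sum>l=1..?N. if l = 1 then ?C \<tau> 1 else 0)"
      by (rule sum.cong) (auto simp: taylor_moment_def delta_moment_def)
    also have "\<dots> = ?C \<tau> 1" by (subst sum.delta) auto
    finally show ?thesis .
  qed
  then show "moment 0 (fin_diff (Suc m) w) = 0"
    unfolding mom' using pf_coeff_snoc(2)[OF ne, of x] by simp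
  have step: "(\<Sum>l=1..?N. ?C \<tau> l * (taylor_moment (Suc k) \<tau> l - x * taylor_moment k \<tau> l))
      = (\<Sum>l=1..?N. ?c \<tau> l * taylor_moment k \<tau> l)" for \<tau>
  proof -
    have "(\<Sum>l=1..?N. ?C \<tau> l * (taylor_moment (Suc k) \<tau> l - x * taylor_moment k \<tau> l))
        = ?C \<tau> 1 * taylor_moment k \<tau> 0 + (\<Sum>l=1..?N. ?c \<tau> l * taylor_moment k \<tau> l)"
    proof (rule multiply_by_node[where r = "\<tau> - x"])
      fix l assume l: "l \<in> {1..?N}"
      then show "taylor_moment (Suc k) \<tau> l - x * taylor_moment k \<tau> l
          = (\<tau> - x) * taylor_moment k \<tau> l + taylor_moment k \<tau> (l - 1)"
        by (simp add: taylor_moment_Suc algebra_simps)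
      show "?c \<tau> l = (\<tau> - x) * ?C \<tau> l + ?C \<tau> (Suc l)"
        using pf_coeff_snoc(1)[OF ne] l by simp
    qed (use top in blast)
    then show ?thesis by (simp add: taylor_moment_def)
  qed
  have "moment (Suc k) (fin_diff (Suc m) w) - x * moment k (fin_diff (Suc m) w)
      = (\<Sum>\<tau>\<in>?S. \<Sum>l=1..?N. ?C \<tau> l * (taylor_moment (Suc k) \<tau> l - x * taylor_moment k \<tau> l))"
    unfolding mom' sum_distrib_left sum_subtractf[symmetric] by (simp only: algebra_simps)
  also have "\<dots> = moment k (fin_diff m w)" unfolding mom step ..
  finally show "moment (Suc k) (fin_diff (Suc m) w)
      = w ! m * moment k (fin_diff (Suc m) w) + moment k (fin_diff m w)"
    by (simp add: x_def algebra_simps)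
qed

text \<open>
  Written over all of \<open>w\<close>: the coefficients \<open>pf_coeff\<close> vanish beyond the multiplicities in the first
  \<open>m\<close> nodes, so the sum may be extended to the multiplicities in \<open>w\<close>.
\<close>

lemma fin_diff_in_span:
  assumes m: "1 \<le> m" and w: "w \<noteq> []"
  shows "fin_diff m w = (\<Sum>\<tau>\<in>set w. \<Sum>l<count_list w \<tau>.
    Poly_Mapping.single (\<tau>, l) (pf_coeff (take m w) \<tau> (Suc l) / fact l))"
proof -
  let ?u = "take m w"
  let ?s = "\<lambda>\<tau> l. Poly_Mapping.single (\<tau>, l) (pf_coeff ?u \<tau> (Suc l) / fact l)"
  have u: "?u \<noteq> []" using assms by auto
  have count: "count_list ?u \<tau> \<le> count_list w \<tau>" for \<tau>
    by (metis append_take_drop_id count_list_append le_add1)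
  have outside: "?s \<tau> l = 0" if "\<not> (\<tau> \<in> set ?u \<and> l < count_list ?u \<tau>)" for \<tau> l
    using pf_coeff_eq_0[OF u, of \<tau> "Suc l"] that by auto
  have "fin_diff m w = (\<Sum>\<tau>\<in>set ?u. \<Sum>l<count_list ?u \<tau>. ?s \<tau> l)"
    unfolding fin_diff_def Let_def
  proof (rule sum.cong[OF refl])
    fix \<tau>
    show "(\<Sum>l=1..count_list ?u \<tau>. Poly_Mapping.single (\<tau>, l - 1) (pf_coeff ?u \<tau> l / fact (l - 1)))
        = (\<Sum>l<count_list ?u \<tau>. ?s \<tau> l)"
      by (rule sum.reindex_bij_witness[of _ Suc "\<lambda>l. l - 1"]) auto
  qed
  also have "\<dots> = (\<Sum>\<tau>\<in>set ?u. \<Sum>l<count_list w \<tau>. ?s \<tau> l)"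
  proof (rule sum.cong[OF refl])
    fix \<tau>
    show "(\<Sum>l<count_list ?u \<tau>. ?s \<tau> l) = (\<Sum>l<count_list w \<tau>. ?s \<tau> l)"
      by (rule sum.mono_neutral_left) (use count outside in \<open>auto intro: less_le_trans\<close>)
  qed
  also have "\<dots> = (\<Sum>\<tau>\<in>set w. \<Sum>l<count_list w \<tau>. ?s \<tau> l)"
    by (rule sum.mono_neutral_left) (use outside set_take_subset[of m w] in auto)
  finally show ?thesis .
qed

lemma scale_comb_single: "scale_comb c (Poly_Mapping.single p a) = Poly_Mapping.single p (c * a)"
  by (rule Poly_Mapping.poly_mapping_eqI) (simp add: lookup_scale_comb Poly_Mapping.lookup_single when_def)

lemma scale_comb_sum: "scale_comb c (\<Sum>i\<in>I. f i) = (\<Sum>i\<in>I. scale_comb c (f i))"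
  by (rule Poly_Mapping.poly_mapping_eqI)
    (simp add: lookup_scale_comb Poly_Mapping.lookup_sum sum_distrib_left)

lemma single_sum: "Poly_Mapping.single p (\<Sum>i\<in>I. f i) = (\<Sum>i\<in>I. Poly_Mapping.single p (f i))"
  by (rule Poly_Mapping.poly_mapping_eqI)
    (simp add: Poly_Mapping.lookup_single Poly_Mapping.lookup_sum when_def)

lemma fin_diff_combination_in_V_space:
  assumes w: "w \<noteq> []"
  shows "(\<Sum>m=1..d. scale_comb (\<beta> ! (m - 1)) (fin_diff m w)) \<in> V_space w"
proof -
  let ?p = "\<lambda>m \<tau> l. pf_coeff (take m w) \<tau> (Suc l) / fact l"
  have "(\<Sum>m=1..d. scale_comb (\<beta> ! (m - 1)) (fin_diff m w))
      = (\<Sum>m=1..d. \<Sum>\<tau>\<in>set w. \<Sum>l<count_list w \<tau>. Poly_Mapping.single (\<tau>, l) (\<beta> ! (m - 1) * ?p m \<tau> l))"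
    by (rule sum.cong[OF refl]) (use fin_diff_in_span[OF _ w] in \<open>simp add: scale_comb_sum scale_comb_single\<close>)
  also have "\<dots> = (\<Sum>\<tau>\<in>set w. \<Sum>l<count_list w \<tau>. \<Sum>m=1..d. Poly_Mapping.single (\<tau>, l) (\<beta> ! (m - 1) * ?p m \<tau> l))"
    by (subst sum.swap, rule sum.cong[OF refl], rule sum.swap)
  also have "\<dots> = (\<Sum>\<tau>\<in>set w. \<Sum>l<count_list w \<tau>. Poly_Mapping.single (\<tau>, l) (\<Sum>m=1..d. \<beta> ! (m - 1) * ?p m \<tau> l))"
    by (simp only: single_sum)
  finally show ?thesis
    unfolding V_space_def mem_Collect_eq
    by (intro exI[of _ "\<lambda>\<tau> l. \<Sum>m=1..d. \<beta> ! (m - 1) * ?p m \<tau> l"]) simp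
qed

section \<open>The Prony problem in the Newton basis\<close>

definition apply_moments :: "(nat \<Rightarrow> 'a :: comm_ring_1) \<Rightarrow> 'a poly \<Rightarrow> 'a" where
  "apply_moments m p = (\<Sum>k\<le>degree p. coeff p k * m k)"

lemma apply_moments_le:
  assumes "degree p \<le> N"
  shows "apply_moments m p = (\<Sum>k\<le>N. coeff p k * m k)"
  unfolding apply_moments_def
  by (rule sum.mono_neutral_left) (use assms in \<open>auto simp: coeff_eq_0\<close>)

lemma apply_moments_mult_linear:
  "apply_moments m ([:- x, 1:] * p) = apply_moments (\<lambda>k. m (Suc k) - x * m k) p"
proof -
  have deg: "degree ([:- x, 1:] * p) \<le> Suc (degree p)"
    using degree_mult_le[of "[:- x, 1:]" p] by (simp add: degree_pCons_le split: if_splits)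
  have "apply_moments m ([:- x, 1:] * p) = (\<Sum>k\<le>Suc (degree p). coeff ([:- x, 1:] * p) k * m k)"
    by (rule apply_moments_le[OF deg])
  also have "\<dots> = (\<Sum>k\<le>Suc (degree p). coeff (pCons 0 p) k * m k) - (\<Sum>k\<le>Suc (degree p). x * coeff p k * m k)"
    by (simp add: sum_subtractf[symmetric] algebra_simps del: sum.atMost_Suc)
  also have "(\<Sum>k\<le>Suc (degree p). coeff (pCons 0 p) k * m k) = (\<Sum>k\<le>degree p. coeff p k * m (Suc k))"
    by (subst sum.atMost_Suc_shift) simp
  also have "(\<Sum>k\<le>Suc (degree p). x * coeff p k * m k) = (\<Sum>k\<le>degree p. x * coeff p k * m k)"
    by (simp add: coeff_eq_0)
  finally show ?thesis
    by (simp add: apply_moments_def sum_subtractf[symmetric] algebra_simps)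
qed

lemma apply_moments_mult_monom:
  "apply_moments m (monom 1 j * p) = (\<Sum>k\<le>degree p. coeff p k * m (j + k))"
proof (induction j arbitrary: m)
  case 0
  then show ?case by (simp add: apply_moments_def)
next
  case (Suc j)
  have "monom 1 (Suc j) * p = [:- 0, 1:] * (monom 1 j * p)" by (simp add: monom_Suc)
  then show ?case by (simp only: apply_moments_mult_linear Suc) simp
qed

lemma apply_moments_combination:
  "apply_moments (\<lambda>k. \<Sum>i\<in>I. b i * a i k) p = (\<Sum>i\<in>I. b i * apply_moments (a i) p)"
  unfolding apply_moments_def sum_distrib_left
  by (subst sum.swap) (simp add: mult.left_commute)

lemma apply_moments_monic:
  assumes "degree p = n" "coeff p n = 1"
  shows "apply_moments m p = m n + (\<Sum>k<n. coeff p k * m k)"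
  using assms by (simp add: apply_moments_def lessThan_Suc_atMost[symmetric])

text \<open>
  A family with one monic polynomial in each degree is triangular over the monomials.
\<close>

lemma moments_eq_iff_on_monic_basis:
  assumes e: "\<And>k. k < n \<Longrightarrow> degree (e k) = k \<and> coeff (e k) k = 1"
  shows "(\<forall>k<n. a k = b k) \<longleftrightarrow> (\<forall>k<n. apply_moments a (e k) = apply_moments b (e k))"
proof
  assume "\<forall>k<n. a k = b k"
  then show "\<forall>k<n. apply_moments a (e k) = apply_moments b (e k)"
    using e by (auto simp: apply_moments_def)
next
  assume eq: "\<forall>k<n. apply_moments a (e k) = apply_moments b (e k)"
  have "k < n \<Longrightarrow> a k = b k" for k
  proof (induction k rule: less_induct)
    case (less k)
    have "(\<Sum>i<k. coeff (e k) i * a i) = (\<Sum>i<k. coeff (e k) i * b i)"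
      by (rule sum.cong) (use less in auto)
    moreover have "apply_moments a (e k) = apply_moments b (e k)" using eq less.prems by blast
    ultimately show "a k = b k" using apply_moments_monic[of "e k" k] e[OF less.prems] by auto
  qed
  then show "\<forall>k<n. a k = b k" by blast
qed

definition newton_poly :: "'a :: comm_ring_1 list \<Rightarrow> nat \<Rightarrow> 'a poly" where
  "newton_poly w j = (\<Prod>x\<leftarrow>take j w. [:- x, 1:])"

lemma newton_poly_0 [simp]: "newton_poly w 0 = 1"
  by (simp add: newton_poly_def)

lemma newton_poly_Suc: "j < length w \<Longrightarrow> newton_poly w (Suc j) = [:- (w ! j), 1:] * newton_poly w j"
  by (simp add: newton_poly_def take_Suc_conv_app_nth mult.commute)

lemma newton_poly_monic:
  fixes w :: "'a :: idom list"
  shows "j \<le> length w \<Longrightarrow> degree (newton_poly w j) = j \<and> coeff (newton_poly w j) j = 1"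
proof (induction j)
  case (Suc j)
  then have IH: "degree (newton_poly w j) = j" "coeff (newton_poly w j) j = 1" by auto
  then have "newton_poly w j \<noteq> 0" by auto
  then have "degree (newton_poly w (Suc j)) = Suc j"
    using Suc.prems IH by (simp add: newton_poly_Suc degree_mult_eq del: mult_pCons_left)
  moreover have "coeff (newton_poly w (Suc j)) (Suc j) = 1"
    using Suc.prems IH by (simp add: newton_poly_Suc coeff_eq_0)
  ultimately show ?case by simp
qed simp

lemma newton_poly_dvd:
  assumes "i \<le> j" shows "newton_poly w i dvd newton_poly w j"
proof -
  have "take j w = take i w @ drop i (take j w)"
    using assms by (metis append_take_drop_id min.absorb1 take_take)
  then show ?thesis unfolding newton_poly_def by (metis dvd_triv_left map_append prod_list.append)
qed

context
  fixes w :: "complex list"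
  assumes w: "w \<noteq> []"
begin

text \<open>
  Each linear factor \<open>x - x\<^sub>m\<close>, split off from the last one on, lowers the order of the difference by one,
  and the first difference is evaluation at \<open>x\<^sub>1\<close>.
\<close>

lemma fin_diff_annihilates:
  assumes "1 \<le> m" "m \<le> length w"
  shows "apply_moments (\<lambda>k. moment k (fin_diff m w)) (newton_poly w m * p) = 0"
  using assms
proof (induction m rule: dec_induct)
  case base
  have "newton_poly w 1 * p = [:- (w ! 0), 1:] * p"
    using w newton_poly_Suc[of 0 w] by simp
  then show ?case
    by (simp only: apply_moments_mult_linear) (simp add: moment_fin_diff_1[OF w, simplified] apply_moments_def)
next
  case (step m)
  have "newton_poly w (Suc m) * p = [:- (w ! m), 1:] * (newton_poly w m * p)"
    using step.prems newton_poly_Suc[of m w] by (simp only: mult.assoc Suc_le_eq)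
  moreover have "(\<lambda>k. moment (Suc k) (fin_diff (Suc m) w) - w ! m * moment k (fin_diff (Suc m) w))
      = (\<lambda>k. moment k (fin_diff m w))"
    using step moment_fin_diff_Suc(2)[of m w] by auto
  ultimately show ?case
    using step by (simp only: apply_moments_mult_linear)
qed

lemma fin_diff_low_moments:
  assumes "1 \<le> m" "m \<le> length w" "k < m"
  shows "moment k (fin_diff m w) = (if Suc k = m then 1 else 0)"
  using assms
proof (induction m arbitrary: k rule: dec_induct)
  case base
  then show ?case using moment_fin_diff_1[OF w] by simp
next
  case (step m)
  have m: "1 \<le> m" "m < length w" using step by auto
  have "k < m \<Longrightarrow> moment k (fin_diff (Suc m) w) = 0" for k
  proof (induction k)
    case 0
    then show ?case using moment_fin_diff_Suc(1)[OF m] by simp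
  next
    case (Suc k)
    then show ?case using moment_fin_diff_Suc(2)[OF m, of k] step.IH[of k] step.prems by simp
  qed
  moreover have "moment m (fin_diff (Suc m) w) = 1"
  proof -
    obtain k where k: "m = Suc k" using m by (cases m) auto
    then show ?thesis
      using moment_fin_diff_Suc(2)[OF m, of k] step.IH[of k] step.prems calculation[of k] by simp
  qed
  ultimately show ?case using step.prems by (cases "k = m") auto
qed

text \<open>
  For \<open>j \<ge> m\<close> the polynomial contains all the first \<open>m\<close> nodes; for \<open>j < m\<close> its degree is at most \<open>m - 1\<close>,
  and there the difference only sees the coefficient of \<open>x\<^bsup>m-1\<^esup>\<close>.
\<close>

lemma fin_diff_dual_to_newton_poly:
  assumes m: "1 \<le> m" "m \<le> length w" and j: "j < length w"
  shows "apply_moments (\<lambda>k. moment k (fin_diff m w)) (newton_poly w j) = (if Suc j = m then 1 else 0)"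
proof (cases "m \<le> j")
  case True
  then obtain p where "newton_poly w j = newton_poly w m * p"
    using newton_poly_dvd by (blast elim: dvdE)
  then show ?thesis using fin_diff_annihilates[OF m] True by simp
next
  case False
  have monic: "degree (newton_poly w j) = j" "coeff (newton_poly w j) j = 1"
    using newton_poly_monic[of j w] j by auto
  have "(\<Sum>k<j. coeff (newton_poly w j) k * moment k (fin_diff m w)) = 0"
    using False fin_diff_low_moments[OF m] by (intro sum.neutral) auto
  then show ?thesis
    using apply_moments_monic[OF monic] fin_diff_low_moments[OF m, of j] False by simp
qed

end

text \<open>
  The moments are compared on the basis \<open>N\<^sub>0, \<dots>, N\<^bsub>d-1\<^esub>, N\<^sub>d, x N\<^sub>d, \<dots>, x\<^bsup>d-1\<^esup> N\<^sub>d\<close>, where those of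
  \<open>\<Sum> \<beta>\<^sub>m \<Delta>\<^sub>m(w)\<close> are \<open>\<beta>\<^sub>1, \<dots>, \<beta>\<^sub>d, 0, \<dots>, 0\<close> by duality.
\<close>

lemma prony_solutions_iff_newton:
  assumes d: "d \<ge> 1" and \<mu>: "length \<mu> = 2 * d" and w: "length w = d" and \<beta>: "length \<beta> = d"
  shows "w @ \<beta> \<in> prony_solutions d \<mu> \<longleftrightarrow>
     (\<forall>j<d. \<beta> ! j = apply_moments ((!) \<mu>) (newton_poly w j)) \<and>
     (\<forall>j<d. apply_moments ((!) \<mu>) (monom 1 j * newton_poly w d) = 0)"
proof -
  have ne: "w \<noteq> []" using d w by auto
  define g where "g = (\<Sum>m=1..d. scale_comb (\<beta> ! (m - 1)) (fin_diff m w))"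
  define e where "e k = (if k < d then newton_poly w k else monom 1 (k - d) * newton_poly w d)" for k
  have monic: "degree (e k) = k \<and> coeff (e k) k = 1" for k
  proof (cases "k < d")
    case True
    then show ?thesis using newton_poly_monic[of k w] w by (simp add: e_def)
  next
    case False
    have N: "degree (newton_poly w d) = d" "coeff (newton_poly w d) d = 1"
      using newton_poly_monic[of d w] w by auto
    then have "newton_poly w d \<noteq> 0" using d by auto
    then have "degree (monom 1 (k - d) * newton_poly w d) = k"
      using N False by (simp add: degree_mult_eq degree_monom_eq)
    then show ?thesis using N False by (simp add: e_def coeff_monom_mult)
  qed
  have moment_g: "(\<lambda>k. moment k g) = (\<lambda>k. \<Sum>m=1..d. \<beta> ! (m - 1) * moment k (fin_diff m w))"
    unfolding g_def by (simp add: moment_sum moment_scale)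
  have low: "apply_moments (\<lambda>k. moment k g) (e j) = \<beta> ! j" if "j < d" for j
  proof -
    have "apply_moments (\<lambda>k. moment k g) (e j)
        = (\<Sum>m=1..d. \<beta> ! (m - 1) * (if Suc j = m then 1 else 0))"
      unfolding moment_g apply_moments_combination
      by (rule sum.cong[OF refl])
        (use that w fin_diff_dual_to_newton_poly[OF ne] in \<open>auto simp: e_def\<close>)
    also have "\<dots> = (\<Sum>m=1..d. if m = Suc j then \<beta> ! j else 0)"
      by (rule sum.cong) auto
    also have "\<dots> = \<beta> ! j" using that by simp
    finally show ?thesis .
  qed
  have high: "apply_moments (\<lambda>k. moment k g) (e j) = 0" if "\<not> j < d" for j
    unfolding moment_g apply_moments_combination
  proof (intro sum.neutral ballI)
    fix m assume m: "m \<in> {1..d}"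
    then obtain p where "newton_poly w d = newton_poly w m * p"
      using newton_poly_dvd[of m d w] by (auto elim: dvdE)
    then have "e j = newton_poly w m * (monom 1 (j - d) * p)" using that by (simp add: e_def mult_ac)
    then show "\<beta> ! (m - 1) * apply_moments (\<lambda>k. moment k (fin_diff m w)) (e j) = 0"
      using fin_diff_annihilates[OF ne, of m] m w by simp
  qed
  have "w @ \<beta> \<in> prony_solutions d \<mu> \<longleftrightarrow> prony_map d (w, g) = \<mu>"
  proof
    assume "w @ \<beta> \<in> prony_solutions d \<mu>"
    then show "prony_map d (w, g) = \<mu>"
      using w \<beta> unfolding prony_solutions_def prony_domain_def g_def by auto
  next
    assume "prony_map d (w, g) = \<mu>"
    then show "w @ \<beta> \<in> prony_solutions d \<mu>"
      using w \<beta> fin_diff_combination_in_V_space[OF ne, of \<beta> d]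
      unfolding prony_solutions_def prony_domain_def g_def by blast
  qed
  also have "\<dots> \<longleftrightarrow> (\<forall>k<2 * d. \<mu> ! k = moment k g)"
    using \<mu> by (auto simp: prony_map_def list_eq_iff_nth_eq)
  also have "\<dots> \<longleftrightarrow> (\<forall>k<2 * d. apply_moments ((!) \<mu>) (e k) = apply_moments (\<lambda>k. moment k g) (e k))"
    by (rule moments_eq_iff_on_monic_basis) (use monic in blast)
  also have "\<dots> \<longleftrightarrow> (\<forall>j<d. \<beta> ! j = apply_moments ((!) \<mu>) (newton_poly w j)) \<and>
     (\<forall>j<d. apply_moments ((!) \<mu>) (monom 1 j * newton_poly w d) = 0)" (is "?l \<longleftrightarrow> ?r")
  proof
    assume l: ?l
    show ?r
    proof (intro conjI allI impI)
      fix j assume j: "j < d"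
      show "\<beta> ! j = apply_moments ((!) \<mu>) (newton_poly w j)"
        using l[rule_format, of j] low[OF j] j by (simp add: e_def)
      show "apply_moments ((!) \<mu>) (monom 1 j * newton_poly w d) = 0"
        using l[rule_format, of "d + j"] high[of "d + j"] j by (simp add: e_def)
    qed
  next
    assume r: ?r
    show ?l
    proof (intro allI impI)
      fix k assume k: "k < 2 * d"
      show "apply_moments ((!) \<mu>) (e k) = apply_moments (\<lambda>k. moment k g) (e k)"
      proof (cases "k < d")
        case True
        then show ?thesis using r low[of k] by (simp add: e_def)
      next
        case False
        then have "k - d < d" using k by simp
        then show ?thesis using r high[of k] False by (simp add: e_def)
      qed
    qed
  qed
  finally show ?thesis .
qed

section \<open>The node polynomial\<close>

definition hankel :: "nat \<Rightarrow> complex list \<Rightarrow> complex mat" where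
  "hankel d \<mu> = Matrix.mat d d (\<lambda>(i, j). \<mu> ! (i + j))"

text \<open>
  The numerator in Cramer's rule for the coefficient of \<open>x\<^sup>k\<close> in the node polynomial.
\<close>

definition hankel_numerator :: "nat \<Rightarrow> complex list \<Rightarrow> nat \<Rightarrow> complex" where
  "hankel_numerator d \<mu> k = - (\<Sum>j<d. adj_mat (hankel d \<mu>) $$ (k, j) * \<mu> ! (d + j))"

lemma hankel_closed [simp]: "hankel d \<mu> \<in> carrier_mat d d"
  by (simp add: hankel_def)

lemma scalar_mat_mult_vec:
  fixes x :: "'a :: comm_ring_1 Matrix.vec"
  assumes x: "x \<in> carrier_vec n"
  shows "(a \<cdot>\<^sub>m 1\<^sub>m n) *\<^sub>v x = a \<cdot>\<^sub>v x"
proof (rule eq_vecI)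
  fix i assume "i < dim_vec (a \<cdot>\<^sub>v x)"
  then have i: "i < n" using x by simp
  have "((a \<cdot>\<^sub>m 1\<^sub>m n) *\<^sub>v x) $ i = (\<Sum>j<n. a * (if j = i then 1 else 0) * x $ j)"
    using i x by (simp add: scalar_prod_def atLeast0LessThan)
  also have "\<dots> = (\<Sum>j<n. if j = i then a * x $ j else 0)"
    by (rule sum.cong) auto
  finally show "((a \<cdot>\<^sub>m 1\<^sub>m n) *\<^sub>v x) $ i = (a \<cdot>\<^sub>v x) $ i" using i x by simp
qed (use x in simp)

text \<open>
  Multiplication by the adjugate turns the Hankel system into \<open>D q = adj(H) b\<close>; it loses nothing
  because the adjugate is invertible up to the nonzero scalar \<open>D\<close>.
\<close>

lemma hankel_cramer:
  assumes D: "Determinant.det (hankel d \<mu>) \<noteq> 0"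
  shows "(\<forall>j<d. (\<Sum>k<d. q k * \<mu> ! (j + k)) + \<mu> ! (j + d) = 0) \<longleftrightarrow>
    (\<forall>k<d. Determinant.det (hankel d \<mu>) * q k = hankel_numerator d \<mu> k)"
proof -
  let ?H = "hankel d \<mu>" and ?A = "adj_mat (hankel d \<mu>)"
  let ?D = "Determinant.det ?H"
  define v where "v = Matrix.vec d q"
  define b where "b = Matrix.vec d (\<lambda>j. - \<mu> ! (d + j))"
  have A: "?A \<in> carrier_mat d d" by (rule adj_mat(1)) simp
  have vb: "v \<in> carrier_vec d" "b \<in> carrier_vec d" by (auto simp: v_def b_def)
  have "(\<forall>j<d. (\<Sum>k<d. q k * \<mu> ! (j + k)) + \<mu> ! (j + d) = 0) \<longleftrightarrow> ?H *\<^sub>v v = b"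
    by (auto simp: vec_eq_iff hankel_def v_def b_def scalar_prod_def atLeast0LessThan
        add_eq_0_iff2 add.commute mult.commute)
  also have "\<dots> \<longleftrightarrow> ?A *\<^sub>v (?H *\<^sub>v v) = ?A *\<^sub>v b"
  proof
    assume "?A *\<^sub>v (?H *\<^sub>v v) = ?A *\<^sub>v b"
    then have "?H *\<^sub>v (?A *\<^sub>v (?H *\<^sub>v v)) = ?H *\<^sub>v (?A *\<^sub>v b)" by simp
    moreover have "?H *\<^sub>v (?A *\<^sub>v x) = ?D \<cdot>\<^sub>v x" if x: "x \<in> carrier_vec d" for x
    proof -
      have "?H *\<^sub>v (?A *\<^sub>v x) = (?H * ?A) *\<^sub>v x"
        by (rule assoc_mult_mat_vec[symmetric, OF hankel_closed A x])
      also have "\<dots> = ?D \<cdot>\<^sub>v x"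
        using x by (simp add: adj_mat(2)[OF hankel_closed] scalar_mat_mult_vec)
      finally show ?thesis .
    qed
    moreover have "?H *\<^sub>v v \<in> carrier_vec d"
      by (rule mult_mat_vec_carrier[OF hankel_closed vb(1)])
    ultimately have "?D \<cdot>\<^sub>v (?H *\<^sub>v v) = ?D \<cdot>\<^sub>v b" using vb by simp
    then have "(1 / ?D) \<cdot>\<^sub>v (?D \<cdot>\<^sub>v (?H *\<^sub>v v)) = (1 / ?D) \<cdot>\<^sub>v (?D \<cdot>\<^sub>v b)" by simp
    then show "?H *\<^sub>v v = b" using D by (simp add: smult_smult_assoc)
  qed simp
  also have "?A *\<^sub>v (?H *\<^sub>v v) = ?D \<cdot>\<^sub>v v"
  proof -
    have "?A *\<^sub>v (?H *\<^sub>v v) = (?A * ?H) *\<^sub>v v"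
      by (rule assoc_mult_mat_vec[symmetric, OF A hankel_closed vb(1)])
    also have "\<dots> = ?D \<cdot>\<^sub>v v"
      using vb by (simp add: adj_mat(3)[OF hankel_closed] scalar_mat_mult_vec)
    finally show ?thesis .
  qed
  also have "?D \<cdot>\<^sub>v v = ?A *\<^sub>v b \<longleftrightarrow> (\<forall>k<d. ?D * q k = hankel_numerator d \<mu> k)"
    using A by (auto simp: vec_eq_iff v_def b_def hankel_numerator_def scalar_prod_def
        atLeast0LessThan sum_negf)
  finally show ?thesis .
qed

text \<open>
  Monic of degree \<open>d\<close> for every argument, since division by a vanishing determinant yields \<open>0\<close>; this
  allows limits along all neighbouring vectors, not only the regular ones.
\<close>

definition node_poly :: "nat \<Rightarrow> complex list \<Rightarrow> complex poly" where
  "node_poly d \<mu> = monom 1 d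
     + (\<Sum>k<d. monom (hankel_numerator d \<mu> k / Determinant.det (hankel d \<mu>)) k)"

lemma coeff_node_poly:
  "coeff (node_poly d \<mu>) k =
    (if k < d then hankel_numerator d \<mu> k / Determinant.det (hankel d \<mu>) else if k = d then 1 else 0)"
  by (auto simp: node_poly_def coeff_sum)

lemma prony_solutions_iff:
  assumes d: "d \<ge> 1" and \<mu>: "\<mu> \<in> hankel_regular d"
    and w: "length w = d" and \<beta>: "length \<beta> = d"
  shows "w @ \<beta> \<in> prony_solutions d \<mu> \<longleftrightarrow>
     newton_poly w d = node_poly d \<mu> \<and>
     (\<forall>j<d. \<beta> ! j = apply_moments ((!) \<mu>) (newton_poly w j))"
proof -
  have len: "length \<mu> = 2 * d" and D: "Determinant.det (hankel d \<mu>) \<noteq> 0"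
    using \<mu> by (auto simp: hankel_regular_def hankel_def)
  have N: "degree (newton_poly w d) = d" "coeff (newton_poly w d) d = 1"
    using newton_poly_monic[of d w] w by auto
  have "apply_moments ((!) \<mu>) (monom 1 j * newton_poly w d)
      = (\<Sum>k<d. coeff (newton_poly w d) k * \<mu> ! (j + k)) + \<mu> ! (j + d)" for j
    unfolding apply_moments_mult_monom using N by (simp add: lessThan_Suc_atMost[symmetric])
  then have "(\<forall>j<d. apply_moments ((!) \<mu>) (monom 1 j * newton_poly w d) = 0) \<longleftrightarrow>
      (\<forall>k<d. Determinant.det (hankel d \<mu>) * coeff (newton_poly w d) k = hankel_numerator d \<mu> k)"
    using hankel_cramer[OF D, of "coeff (newton_poly w d)"] by simp
  also have "\<dots> \<longleftrightarrow> (\<forall>k<d. coeff (newton_poly w d) k = coeff (node_poly d \<mu>) k)"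
    using D by (auto simp: coeff_node_poly field_simps)
  also have "\<dots> \<longleftrightarrow> newton_poly w d = node_poly d \<mu>"
    unfolding poly_eq_iff using N by (auto simp: coeff_node_poly coeff_eq_0 not_less le_less)
  finally show ?thesis using prony_solutions_iff_newton[OF d len w \<beta>] by blast
qed

lemma prony_solutions_eq:
  assumes d: "d \<ge> 1" and \<mu>: "\<mu> \<in> hankel_regular d"
  shows "prony_solutions d \<mu> =
     (\<lambda>w. w @ map (\<lambda>j. apply_moments ((!) \<mu>) (newton_poly w j)) [0..<d]) `
       {w. length w = d \<and> newton_poly w d = node_poly d \<mu>}"
proof (rule subset_antisym; rule subsetI)
  fix s assume s: "s \<in> prony_solutions d \<mu>"
  then obtain w \<beta> where wb: "s = w @ \<beta>" "length w = d" "length \<beta> = d"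
    unfolding prony_solutions_def prony_domain_def by auto
  then have "newton_poly w d = node_poly d \<mu>"
    and \<beta>: "\<forall>j<d. \<beta> ! j = apply_moments ((!) \<mu>) (newton_poly w j)"
    using s prony_solutions_iff[OF d \<mu>, of w \<beta>] by blast+
  moreover have "\<beta> = map (\<lambda>j. apply_moments ((!) \<mu>) (newton_poly w j)) [0..<d]"
    by (rule nth_equalityI) (use wb(3) \<beta> in auto)
  ultimately show "s \<in> (\<lambda>w. w @ map (\<lambda>j. apply_moments ((!) \<mu>) (newton_poly w j)) [0..<d]) `
       {w. length w = d \<and> newton_poly w d = node_poly d \<mu>}"
    using wb by blast
next
  fix s assume "s \<in> (\<lambda>w. w @ map (\<lambda>j. apply_moments ((!) \<mu>) (newton_poly w j)) [0..<d]) `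
       {w. length w = d \<and> newton_poly w d = node_poly d \<mu>}"
  then show "s \<in> prony_solutions d \<mu>"
    using prony_solutions_iff[OF d \<mu>] by auto
qed

section \<open>Convergence of complex vectors\<close>

text \<open>
  Lists carry no topology; this filter plays the role of the neighbourhood filter of \<open>\<mu>\<close> in \<open>\<complex>\<^sup>n\<close>, so that
  the calculus of limits is available.
\<close>

definition vec_nhds :: "complex list \<Rightarrow> complex list filter" where
  "vec_nhds \<mu> = inf (filtercomap (vec_dist \<mu>) (nhds 0)) (principal {\<nu>. length \<nu> = length \<mu>})"

lemma vec_dist_nonneg: "vec_dist x y \<ge> 0"
  by (simp add: vec_dist_def L2_set_nonneg)

lemma eventually_vec_nhds:
  "eventually P (vec_nhds \<mu>) \<longleftrightarrow>
     (\<exists>\<eta>>0. \<forall>\<nu>. length \<nu> = length \<mu> \<longrightarrow> vec_dist \<mu> \<nu> < \<eta> \<longrightarrow> P \<nu>)"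
proof
  assume "eventually P (vec_nhds \<mu>)"
  then obtain Q where Q: "eventually Q (nhds (0::real))"
    and P: "\<And>\<nu>. Q (vec_dist \<mu> \<nu>) \<Longrightarrow> length \<nu> = length \<mu> \<Longrightarrow> P \<nu>"
    unfolding vec_nhds_def eventually_inf_principal eventually_filtercomap by auto
  from Q obtain \<eta> where "\<eta> > 0" "\<And>x. dist x 0 < \<eta> \<Longrightarrow> Q x"
    unfolding eventually_nhds_metric by blast
  then show "\<exists>\<eta>>0. \<forall>\<nu>. length \<nu> = length \<mu> \<longrightarrow> vec_dist \<mu> \<nu> < \<eta> \<longrightarrow> P \<nu>"
    using P vec_dist_nonneg by (intro exI[of _ \<eta>]) auto
next
  assume "\<exists>\<eta>>0. \<forall>\<nu>. length \<nu> = length \<mu> \<longrightarrow> vec_dist \<mu> \<nu> < \<eta> \<longrightarrow> P \<nu>"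
  then obtain \<eta> where \<eta>: "\<eta> > 0" "\<And>\<nu>. length \<nu> = length \<mu> \<Longrightarrow> vec_dist \<mu> \<nu> < \<eta> \<Longrightarrow> P \<nu>" by blast
  have "eventually (\<lambda>x. x < \<eta>) (nhds (0::real))"
    using \<eta>(1) by (intro eventually_nhds_in_open[of "{..<\<eta>}", simplified]) auto
  then show "eventually P (vec_nhds \<mu>)"
    unfolding vec_nhds_def eventually_inf_principal eventually_filtercomap using \<eta>(2) by fastforce
qed

lemma tendsto_coordinate:
  assumes i: "i < length \<mu>"
  shows "((\<lambda>\<nu>. \<nu> ! i) \<longlongrightarrow> \<mu> ! i) (vec_nhds \<mu>)"
proof (rule tendstoI)
  fix e :: real assume e: "e > 0"
  have "dist (\<nu> ! i) (\<mu> ! i) \<le> vec_dist \<mu> \<nu>" for \<nu>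
    using member_le_L2_set[of "{..<length \<mu>}" i "\<lambda>i. dist (\<mu> ! i) (\<nu> ! i)"] i
    by (simp add: vec_dist_def dist_commute)
  then show "eventually (\<lambda>\<nu>. dist (\<nu> ! i) (\<mu> ! i) < e) (vec_nhds \<mu>)"
    unfolding eventually_vec_nhds using e by (meson le_less_trans)
qed

lemma tendsto_coord_polynomial:
  assumes "coord_polynomial n p" "n = length \<mu>"
  shows "(p \<longlongrightarrow> p \<mu>) (vec_nhds \<mu>)"
  using assms by induction (auto intro!: tendsto_intros tendsto_coordinate)

lemma tendsto_vec_dist_0:
  assumes "\<And>i. i < length a \<Longrightarrow> ((\<lambda>x. s x ! i) \<longlongrightarrow> a ! i) F"
  shows "((\<lambda>x. vec_dist a (s x)) \<longlongrightarrow> 0) F"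
proof -
  have "((\<lambda>x. sqrt (\<Sum>i<length a. (dist (a ! i) (s x ! i))\<^sup>2)) \<longlongrightarrow>
      sqrt (\<Sum>i<length a. (dist (a ! i) (a ! i))\<^sup>2)) F"
    by (intro tendsto_intros assms) auto
  then show ?thesis by (simp add: vec_dist_def L2_set_def)
qed

text \<open>
  Finiteness matters: the suprema are attained, so the strict bound survives.
\<close>

lemma hausdorff_dist_less:
  assumes fin: "finite A" "A \<noteq> {}" "finite B" "B \<noteq> {}"
    and AB: "\<And>a. a \<in> A \<Longrightarrow> \<exists>b\<in>B. vec_dist a b < e"
    and BA: "\<And>b. b \<in> B \<Longrightarrow> \<exists>a\<in>A. vec_dist a b < e"
  shows "hausdorff_dist A B < e"
proof -
  have half: "(SUP a\<in>X. INF b\<in>Y. f a b) < e"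
    if X: "finite X" "X \<noteq> {}" and Y: "finite Y" and near: "\<And>a. a \<in> X \<Longrightarrow> \<exists>b\<in>Y. f a b < e"
    for X Y :: "complex list set" and f :: "complex list \<Rightarrow> complex list \<Rightarrow> real"
  proof -
    have "(INF b\<in>Y. f a b) < e" if a: "a \<in> X" for a
    proof -
      obtain b where b: "b \<in> Y" "f a b < e" using near[OF a] by blast
      have "(INF b\<in>Y. f a b) \<le> f a b"
        by (rule cINF_lower) (use Y b in auto)
      then show ?thesis using b by simp
    qed
    then show ?thesis using X by (subst cSup_eq_Max) auto
  qed
  have "(SUP a\<in>A. INF b\<in>B. vec_dist a b) < e"
    using half[of A B vec_dist] fin AB by blast
  moreover have "(SUP b\<in>B. INF a\<in>A. vec_dist a b) < e"
    using half[of B A "\<lambda>b a. vec_dist a b"] fin BA by blast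
  ultimately show ?thesis unfolding hausdorff_dist_def by simp
qed

section \<open>Polynomial functions of the moments\<close>

lemma closed_under_sum:
  fixes P :: "('b \<Rightarrow> 'a :: comm_ring_1) \<Rightarrow> bool"
  assumes "\<And>c. P (\<lambda>_. c)" "\<And>f g. P f \<Longrightarrow> P g \<Longrightarrow> P (\<lambda>x. f x + g x)"
    and "\<And>i. i \<in> I \<Longrightarrow> P (f i)"
  shows "P (\<lambda>x. \<Sum>i\<in>I. f i x)"
  using assms(3) by (induction I rule: infinite_finite_induct) (auto intro: assms(1,2))

lemma closed_under_prod:
  fixes P :: "('b \<Rightarrow> 'a :: comm_ring_1) \<Rightarrow> bool"
  assumes "\<And>c. P (\<lambda>_. c)" "\<And>f g. P f \<Longrightarrow> P g \<Longrightarrow> P (\<lambda>x. f x * g x)"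
    and "\<And>i. i \<in> I \<Longrightarrow> P (f i)"
  shows "P (\<lambda>x. \<Prod>i\<in>I. f i x)"
  using assms(3) by (induction I rule: infinite_finite_induct) (auto intro: assms(1,2))

text \<open>
  Stated for an arbitrary class of functions closed under ring operations, because it is needed both for
  polynomial functions and for functions with values in polynomials.
\<close>

lemma closed_under_det:
  fixes P :: "('b \<Rightarrow> 'a :: comm_ring_1) \<Rightarrow> bool"
  assumes const: "\<And>c. P (\<lambda>_. c)" and add: "\<And>f g. P f \<Longrightarrow> P g \<Longrightarrow> P (\<lambda>x. f x + g x)"
    and mult: "\<And>f g. P f \<Longrightarrow> P g \<Longrightarrow> P (\<lambda>x. f x * g x)"
    and dim: "\<And>x. A x \<in> carrier_mat n n"
    and entry: "\<And>i j. i < n \<Longrightarrow> j < n \<Longrightarrow> P (\<lambda>x. A x $$ (i, j))"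
  shows "P (\<lambda>x. Determinant.det (A x))"
proof -
  have "P (\<lambda>x. \<Sum>p\<in>{p. p permutes {0..<n}}. signof p * (\<Prod>i=0..<n. A x $$ (i, p i)))"
  proof (rule closed_under_sum[where P = P])
    fix p assume "p \<in> {p. p permutes {0..<n}}"
    then have p: "i < n \<Longrightarrow> p i < n" for i
      using permutes_in_image[of p "{0..<n}" i] by auto
    show "P (\<lambda>x. signof p * (\<Prod>i=0..<n. A x $$ (i, p i)))"
      by (intro mult const closed_under_prod[where P = P] entry) (use p in auto)
  qed (use const add in auto)
  then show ?thesis by (simp add: det_def'[OF dim])
qed

lemma coord_polynomial_sum:
  "(\<And>i. i \<in> I \<Longrightarrow> coord_polynomial n (f i)) \<Longrightarrow> coord_polynomial n (\<lambda>x. \<Sum>i\<in>I. f i x)"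
  by (rule closed_under_sum) (auto intro: coord_polynomial.intros)

lemma coord_polynomial_det:
  assumes "\<And>x. A x \<in> carrier_mat k k"
    and "\<And>i j. i < k \<Longrightarrow> j < k \<Longrightarrow> coord_polynomial n (\<lambda>x. A x $$ (i, j))"
  shows "coord_polynomial n (\<lambda>x. Determinant.det (A x))"
  by (rule closed_under_det[where P = "coord_polynomial n"])
    (use assms in \<open>auto intro: coord_polynomial.intros\<close>)

lemma coord_polynomial_uminus: "coord_polynomial n p \<Longrightarrow> coord_polynomial n (\<lambda>x. - p x)"
  using coord_polynomial.mult[OF coord_polynomial.const[of n "- 1"], of p] by simp

lemma coord_polynomial_power: "coord_polynomial n p \<Longrightarrow> coord_polynomial n (\<lambda>x. p x ^ k)"
  by (induction k) (auto intro: coord_polynomial.intros)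

lemma coord_polynomial_hankel_entry:
  "i < d \<Longrightarrow> j < d \<Longrightarrow> coord_polynomial (2 * d) (\<lambda>\<mu>. hankel d \<mu> $$ (i, j))"
  by (simp add: hankel_def coord_polynomial.coord)

lemma coord_polynomial_det_hankel:
  "coord_polynomial (2 * d) (\<lambda>\<mu>. Determinant.det (hankel d \<mu>))"
  by (rule coord_polynomial_det[where k = d]) (simp_all add: coord_polynomial_hankel_entry)

lemma coord_polynomial_hankel_numerator:
  assumes k: "k < d"
  shows "coord_polynomial (2 * d) (\<lambda>\<mu>. hankel_numerator d \<mu> k)"
proof -
  have "coord_polynomial (2 * d) (\<lambda>\<mu>. adj_mat (hankel d \<mu>) $$ (k, j))" if j: "j < d" for j
  proof -
    have "coord_polynomial (2 * d) (\<lambda>\<mu>. (- 1) ^ (j + k) * Determinant.det (mat_delete (hankel d \<mu>) j k))"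
    proof (intro coord_polynomial.mult coord_polynomial.const coord_polynomial_det[where k = "d - 1"])
      fix \<mu> show "mat_delete (hankel d \<mu>) j k \<in> carrier_mat (d - 1) (d - 1)"
        by (simp add: mat_delete_def hankel_def)
    next
      fix i i' assume "i < d - 1" "i' < d - 1"
      then show "coord_polynomial (2 * d) (\<lambda>\<mu>. mat_delete (hankel d \<mu>) j k $$ (i, i'))"
        by (simp add: mat_delete_def hankel_def coord_polynomial.coord)
    qed
    then show ?thesis using j k by (simp add: adj_mat_def cofactor_def hankel_def)
  qed
  then show ?thesis unfolding hankel_numerator_def
    by (intro coord_polynomial_uminus coord_polynomial_sum coord_polynomial.mult coord_polynomial.coord) auto
qed

section \<open>Continuity of roots\<close>

lemma norm_poly_linear_factors_ge:
  fixes R :: "complex list"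
  assumes "m \<ge> 0" "\<And>r. r \<in> set R \<Longrightarrow> m \<le> norm (a - r)"
  shows "m ^ length R \<le> norm (poly (\<Prod>r\<leftarrow>R. [:- r, 1:]) a)"
  using assms(2)
proof (induction R)
  case (Cons r R)
  have "m * m ^ length R \<le> norm (a - r) * norm (poly (\<Prod>r\<leftarrow>R. [:- r, 1:]) a)"
    by (rule mult_mono) (use Cons assms(1) in auto)
  moreover have "poly (\<Prod>r\<leftarrow>r # R. [:- r, 1:]) a = (a - r) * poly (\<Prod>r\<leftarrow>R. [:- r, 1:]) a"
    by (simp add: algebra_simps)
  ultimately show ?case by (simp only: norm_mult length_Cons power_Suc)
qed simp

text \<open>
  \<open>|p(a)|\<close> is the product of the distances from \<open>a\<close> to the \<open>n + 1\<close> roots, hence at least the \<open>(n + 1)\<close>-st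
  power of the smallest of them.
\<close>

lemma nearest_root_bound:
  fixes p :: "complex poly"
  assumes deg: "degree p = Suc n" and lead: "coeff p (Suc n) = 1"
  shows "\<exists>b. poly p b = 0 \<and> norm (a - b) ^ Suc n \<le> norm (poly p a)"
proof -
  obtain R where R: "(\<Prod>r\<leftarrow>R. [:- r, 1:]) = p" "length R = Suc n"
    using fundamental_theorem_algebra_factorized[of p] deg lead by auto
  let ?N = "(\<lambda>r. norm (a - r)) ` set R"
  have ne: "?N \<noteq> {}" using R(2) by auto
  have "Min ?N \<in> ?N" by (rule Min_in) (use ne in auto)
  then obtain b where b: "b \<in> set R" "Min ?N = norm (a - b)" by blast
  have "norm (a - b) ^ length R \<le> norm (poly (\<Prod>r\<leftarrow>R. [:- r, 1:]) a)"
    by (rule norm_poly_linear_factors_ge) (unfold b(2)[symmetric], use Min_le[of ?N] b(2) in auto)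
  moreover have "poly p b = 0"
    using b(1) unfolding R(1)[symmetric] poly_prod_list by (auto simp: prod_list_zero_iff)
  ultimately show ?thesis using R by auto
qed

lemma tendsto_0_of_power:
  fixes f :: "'a \<Rightarrow> complex"
  assumes "((\<lambda>x. norm (f x) ^ Suc n) \<longlongrightarrow> 0) F"
  shows "(f \<longlongrightarrow> 0) F"
proof (rule tendstoI)
  fix e :: real assume e: "e > 0"
  then have "eventually (\<lambda>x. dist (norm (f x) ^ Suc n) 0 < e ^ Suc n) F"
    by (intro tendstoD[OF assms]) simp
  then show "eventually (\<lambda>x. dist (f x) 0 < e) F"
  proof (rule eventually_mono)
    fix x assume "dist (norm (f x) ^ Suc n) 0 < e ^ Suc n"
    then have "norm (f x) ^ Suc n < e ^ Suc n"
      by (simp only: dist_real_def diff_zero abs_of_nonneg[OF zero_le_power[OF norm_ge_zero]])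
    then show "dist (f x) 0 < e" using power_less_imp_less_base[of "norm (f x)" "Suc n" e] e by simp
  qed
qed

lemma coeff_mult_linear:
  fixes x :: "'a :: comm_ring_1"
  shows "coeff ([:- x, 1:] * p) k = (case k of 0 \<Rightarrow> 0 | Suc i \<Rightarrow> coeff p i) - x * coeff p k"
  by (cases k) auto

text \<open>
  Choose a root \<open>b\<close> of the approximating polynomial nearest to a root \<open>a\<close> of the limit; it tends to \<open>a\<close> because
  the value at \<open>a\<close> tends to \<open>0\<close>.  Synthetic division by \<open>x - b\<close> is continuous in the coefficients and
  \<open>b\<close>, so the quotients converge as well and induction applies.
\<close>

lemma roots_tendsto:
  fixes P :: "'a \<Rightarrow> complex poly"
  assumes "\<And>x. degree (P x) = length w" "\<And>x. coeff (P x) (length w) = 1"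
    and "\<And>k. ((\<lambda>x. coeff (P x) k) \<longlongrightarrow> coeff (\<Prod>a\<leftarrow>w. [:- a, 1:]) k) F"
  shows "\<exists>W. (\<forall>x. length (W x) = length w \<and> P x = (\<Prod>a\<leftarrow>W x. [:- a, 1:])) \<and>
    (\<forall>i<length w. ((\<lambda>x. W x ! i) \<longlongrightarrow> w ! i) F)"
  using assms
proof (induction w arbitrary: P)
  case Nil
  have "P x = 1" for x using Nil.prems(1)[of x] Nil.prems(2)[of x] by (auto elim!: degree_eq_zeroE)
  then show ?case by (intro exI[of _ "\<lambda>_. []"]) auto
next
  case (Cons a w)
  let ?n = "length w" and ?q = "\<Prod>a\<leftarrow>w. [:- a, 1:]"
  have "\<exists>b. \<forall>x. poly (P x) (b x) = 0 \<and> norm (a - b x) ^ Suc ?n \<le> norm (poly (P x) a)"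
    using nearest_root_bound Cons.prems(1,2) by (intro choice allI) auto
  then obtain b where b: "\<And>x. poly (P x) (b x) = 0"
    "\<And>x. norm (a - b x) ^ Suc ?n \<le> norm (poly (P x) a)" by blast
  have "((\<lambda>x. \<Sum>k\<le>Suc ?n. coeff (P x) k * a ^ k) \<longlongrightarrow>
      (\<Sum>k\<le>Suc ?n. coeff ([:- a, 1:] * ?q) k * a ^ k)) F"
    using Cons.prems(3) by (intro tendsto_intros) simp
  moreover have "(\<Sum>k\<le>Suc ?n. coeff ([:- a, 1:] * ?q) k * a ^ k) = poly ([:- a, 1:] * ?q) a"
  proof -
    have "degree ([:- a, 1:] * ?q) = Suc ?n"
      using newton_poly_monic[of "length (a # w)" "a # w"]
      by (simp add: newton_poly_def del: mult_pCons_left)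
    then show ?thesis by (simp only: poly_altdef[of "[:- a, 1:] * ?q"])
  qed
  moreover have "poly (P x) a = (\<Sum>k\<le>Suc ?n. coeff (P x) k * a ^ k)" for x
    using Cons.prems(1)[of x] by (simp only: poly_altdef length_Cons)
  ultimately have "((\<lambda>x. poly (P x) a) \<longlongrightarrow> 0) F" by simp
  then have "((\<lambda>x. norm (poly (P x) a)) \<longlongrightarrow> 0) F" by (rule tendsto_norm_zero)
  then have "((\<lambda>x. norm (a - b x) ^ Suc ?n) \<longlongrightarrow> 0) F"
    by (rule tendsto_sandwich[OF _ _ tendsto_const, rotated 2])
      (use b(2) in \<open>auto intro!: always_eventually\<close>)
  then have "((\<lambda>x. a - b x) \<longlongrightarrow> 0) F" by (rule tendsto_0_of_power)
  then have "((\<lambda>x. a - (a - b x)) \<longlongrightarrow> a - 0) F" by (intro tendsto_intros)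
  then have b_lim: "(b \<longlongrightarrow> a) F" by simp
  have "\<exists>Q. \<forall>x. P x = [:- b x, 1:] * Q x"
    using b(1) by (intro choice allI) (metis dvdE poly_eq_0_iff_dvd)
  then obtain Q where Q: "\<And>x. P x = [:- b x, 1:] * Q x" by blast
  have degQ: "degree (Q x) = ?n" for x
  proof -
    have "P x \<noteq> 0" using Cons.prems(1)[of x] by auto
    then have "Q x \<noteq> 0" using Q by auto
    then have "degree (P x) = Suc (degree (Q x))"
      unfolding Q by (subst degree_mult_eq) auto
    then show ?thesis using Cons.prems(1)[of x] by simp
  qed
  have stepQ: "coeff (Q x) k = coeff (P x) (Suc k) + b x * coeff (Q x) (Suc k)" for x k
    unfolding Q coeff_mult_linear by simp
  have leadQ: "coeff (Q x) ?n = 1" for x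
    using stepQ[of x ?n] Cons.prems(2)[of x] degQ[of x] by (simp add: coeff_eq_0)
  have stepq: "coeff ?q k = coeff ([:- a, 1:] * ?q) (Suc k) + a * coeff ?q (Suc k)" for k
    unfolding coeff_mult_linear by simp
  have degq: "degree ?q = ?n" using newton_poly_monic[of ?n w] by (simp add: newton_poly_def)
  \<comment> \<open>Synthetic division computes the coefficients from the top down, so the induction runs downwards in
    \<open>k\<close>, with \<open>m\<close> measuring the distance from the vanishing coefficients above the degree.\<close>
  have limQ: "Suc ?n \<le> k + m \<Longrightarrow> ((\<lambda>x. coeff (Q x) k) \<longlongrightarrow> coeff ?q k) F" for k m
  proof (induction m arbitrary: k)
    case 0
    then show ?case using degQ degq by (simp add: coeff_eq_0)
  next
    case (Suc m)
    have "((\<lambda>x. coeff (P x) (Suc k)) \<longlongrightarrow> coeff ([:- a, 1:] * ?q) (Suc k)) F"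
      using Cons.prems(3)[of "Suc k"] by simp
    moreover have "((\<lambda>x. coeff (Q x) (Suc k)) \<longlongrightarrow> coeff ?q (Suc k)) F"
      using Suc.IH[of "Suc k"] Suc.prems by simp
    ultimately have "((\<lambda>x. coeff (P x) (Suc k) + b x * coeff (Q x) (Suc k)) \<longlongrightarrow>
        coeff ([:- a, 1:] * ?q) (Suc k) + a * coeff ?q (Suc k)) F"
      using b_lim by (intro tendsto_intros)
    then show ?case unfolding stepQ[symmetric] stepq[symmetric] .
  qed
  have "\<exists>W. (\<forall>x. length (W x) = ?n \<and> Q x = (\<Prod>a\<leftarrow>W x. [:- a, 1:])) \<and>
      (\<forall>i<?n. ((\<lambda>x. W x ! i) \<longlongrightarrow> w ! i) F)"
    by (rule Cons.IH) (use degQ leadQ limQ[of _ "Suc ?n"] in auto)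
  then obtain W where W: "\<And>x. length (W x) = ?n" "\<And>x. Q x = (\<Prod>a\<leftarrow>W x. [:- a, 1:])"
    "\<And>i. i < ?n \<Longrightarrow> ((\<lambda>x. W x ! i) \<longlongrightarrow> w ! i) F" by blast
  have "((\<lambda>x. (b x # W x) ! i) \<longlongrightarrow> (a # w) ! i) F" if "i < Suc ?n" for i
    using that b_lim W(3) by (cases i) auto
  moreover have "P x = (\<Prod>a\<leftarrow>b x # W x. [:- a, 1:])" for x
    using Q[of x] W(2)[of x] by simp
  ultimately show ?case using W(1) by (intro exI[of _ "\<lambda>x. b x # W x"]) auto
qed

lemma linear_factors_determine_mset:
  fixes v w :: "complex list"
  assumes "(\<Prod>a\<leftarrow>v. [:- a, 1:]) = (\<Prod>a\<leftarrow>w. [:- a, 1:])"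
  shows "mset v = mset w"
  using assms
proof (induction v arbitrary: w)
  case Nil
  have "degree (\<Prod>a\<leftarrow>w. [:- a, 1:]) = length w"
    using newton_poly_monic[of "length w" w] by (simp add: newton_poly_def)
  then show ?case using Nil by (metis degree_1 length_0_conv list.simps(8) prod_list.Nil)
next
  case (Cons a v)
  have "poly (\<Prod>a\<leftarrow>w. [:- a, 1:]) a = 0"
    unfolding Cons.prems[symmetric] by simp
  then have "a \<in> set w" unfolding poly_prod_list by (auto simp: prod_list_zero_iff)
  then have w: "mset w = mset (a # remove1 a w)" by simp
  then have "mset (map (\<lambda>a. [:- a, 1:]) w) = mset (map (\<lambda>a. [:- a, 1:]) (a # remove1 a w))"
    by (simp only: mset_map)
  then have "(\<Prod>a\<leftarrow>w. [:- a, 1:]) = (\<Prod>a\<leftarrow>a # remove1 a w. [:- a, 1:])"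
    by (metis prod_mset_prod_list)
  then have "[:- a, 1:] * (\<Prod>a\<leftarrow>v. [:- a, 1:]) = [:- a, 1:] * (\<Prod>a\<leftarrow>remove1 a w. [:- a, 1:])"
    using Cons.prems by (simp only: list.map prod_list.Cons)
  then have "(\<Prod>a\<leftarrow>v. [:- a, 1:]) = (\<Prod>a\<leftarrow>remove1 a w. [:- a, 1:])"
    by (subst (asm) mult_cancel_left) auto
  then have "mset v = mset (remove1 a w)" by (rule Cons.IH)
  then show ?case by (simp only: w mset.simps)
qed

section \<open>Continuity of the solution set\<close>

lemma newton_poly_coeff_tendsto:
  fixes v :: "complex list"
  assumes len: "\<And>x. length (V x) = length v"
    and lim: "\<And>i. i < length v \<Longrightarrow> ((\<lambda>x. V x ! i) \<longlongrightarrow> v ! i) F"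
  shows "j \<le> length v \<Longrightarrow> ((\<lambda>x. coeff (newton_poly (V x) j) k) \<longlongrightarrow> coeff (newton_poly v j) k) F"
proof (induction j arbitrary: k)
  case 0
  then show ?case by simp
next
  case (Suc j)
  have "newton_poly (V x) (Suc j) = [:- (V x ! j), 1:] * newton_poly (V x) j" for x
    using Suc.prems len by (intro newton_poly_Suc) simp
  moreover have "newton_poly v (Suc j) = [:- (v ! j), 1:] * newton_poly v j"
    using Suc.prems by (intro newton_poly_Suc) simp
  moreover have "((\<lambda>x. (case k of 0 \<Rightarrow> 0 | Suc i \<Rightarrow> coeff (newton_poly (V x) j) i)
      - V x ! j * coeff (newton_poly (V x) j) k) \<longlongrightarrow>
      (case k of 0 \<Rightarrow> 0 | Suc i \<Rightarrow> coeff (newton_poly v j) i) - v ! j * coeff (newton_poly v j) k) F"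
    using Suc by (cases k) (auto intro!: tendsto_intros lim)
  ultimately show ?case by (simp only: coeff_mult_linear)
qed

text \<open>
  The only candidate for a solution with node list \<open>w\<close>.
\<close>

definition prony_vector :: "nat \<Rightarrow> complex list \<Rightarrow> complex list \<Rightarrow> complex list" where
  "prony_vector d \<mu> w = w @ map (\<lambda>j. apply_moments ((!) \<mu>) (newton_poly w j)) [0..<d]"

lemma length_prony_vector [simp]: "length (prony_vector d \<mu> w) = length w + d"
  by (simp add: prony_vector_def)

lemma prony_vector_nth:
  assumes w: "length w = d" and i: "i < 2 * d"
  shows "prony_vector d \<mu> w ! i =
    (if i < d then w ! i else (\<Sum>k\<le>i - d. coeff (newton_poly w (i - d)) k * \<mu> ! k))"
proof (cases "i < d")
  case False
  then have "i - d < d" using i by simp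
  then show ?thesis
    using False w newton_poly_monic[of "i - d" w]
    by (simp add: prony_vector_def nth_append apply_moments_def)
qed (simp add: prony_vector_def nth_append w)

lemma prony_vector_tendsto:
  assumes v: "length v = d" and \<mu>: "length \<mu> = 2 * d"
    and len: "\<And>\<nu>. length (V \<nu>) = d"
    and lim: "\<And>i. i < d \<Longrightarrow> ((\<lambda>\<nu>. V \<nu> ! i) \<longlongrightarrow> v ! i) (vec_nhds \<mu>)"
  shows "((\<lambda>\<nu>. vec_dist (prony_vector d \<mu> v) (prony_vector d \<nu> (V \<nu>))) \<longlongrightarrow> 0) (vec_nhds \<mu>)"
proof (rule tendsto_vec_dist_0)
  fix i assume "i < length (prony_vector d \<mu> v)"
  then have i: "i < 2 * d" using v by simp
  show "((\<lambda>\<nu>. prony_vector d \<nu> (V \<nu>) ! i) \<longlongrightarrow> prony_vector d \<mu> v ! i) (vec_nhds \<mu>)"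
  proof (cases "i < d")
    case True
    then show ?thesis using lim by (simp add: prony_vector_nth[OF len i] prony_vector_nth[OF v i])
  next
    case False
    have "((\<lambda>\<nu>. coeff (newton_poly (V \<nu>) (i - d)) k) \<longlongrightarrow> coeff (newton_poly v (i - d)) k) (vec_nhds \<mu>)" for k
      by (rule newton_poly_coeff_tendsto) (use v len lim i in auto)
    then have "((\<lambda>\<nu>. \<Sum>k\<le>i - d. coeff (newton_poly (V \<nu>) (i - d)) k * \<nu> ! k) \<longlongrightarrow>
        (\<Sum>k\<le>i - d. coeff (newton_poly v (i - d)) k * \<mu> ! k)) (vec_nhds \<mu>)"
      by (intro tendsto_intros tendsto_coordinate) (use i \<mu> in auto)
    then show ?thesis using False by (simp add: prony_vector_nth[OF len i] prony_vector_nth[OF v i])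
  qed
qed

lemma node_poly_monic: "degree (node_poly d \<mu>) = d \<and> coeff (node_poly d \<mu>) d = 1"
proof -
  have "degree (node_poly d \<mu>) \<le> d" by (rule degree_le) (simp add: coeff_node_poly)
  moreover have "d \<le> degree (node_poly d \<mu>)" by (rule le_degree) (simp add: coeff_node_poly)
  ultimately show ?thesis by (simp add: coeff_node_poly)
qed

lemma hankel_regular_iff:
  "\<mu> \<in> hankel_regular d \<longleftrightarrow> length \<mu> = 2 * d \<and> Determinant.det (hankel d \<mu>) \<noteq> 0"
  by (simp add: hankel_regular_def hankel_def)

lemma node_poly_coeff_tendsto:
  assumes \<mu>: "\<mu> \<in> hankel_regular d"
  shows "((\<lambda>\<nu>. coeff (node_poly d \<nu>) k) \<longlongrightarrow> coeff (node_poly d \<mu>) k) (vec_nhds \<mu>)"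
proof -
  have "((\<lambda>\<nu>. hankel_numerator d \<nu> k / Determinant.det (hankel d \<nu>)) \<longlongrightarrow>
      hankel_numerator d \<mu> k / Determinant.det (hankel d \<mu>)) (vec_nhds \<mu>)" if "k < d"
    using \<mu> that unfolding hankel_regular_iff
    by (intro tendsto_divide tendsto_coord_polynomial[where n = "2 * d"]
        coord_polynomial_det_hankel coord_polynomial_hankel_numerator) auto
  then show ?thesis by (auto simp: coeff_node_poly)
qed

text \<open>
  Unique factorization: two listings of the roots of one polynomial differ by a permutation.
\<close>

lemma node_lists_eq_permutations:
  fixes w :: "complex list"
  assumes w: "length w = d" "newton_poly w d = p"
  shows "{v. length v = d \<and> newton_poly v d = p} = (\<lambda>\<sigma>. permute_list \<sigma> w) ` {\<sigma>. \<sigma> permutes {..<d}}"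
proof (rule subset_antisym; rule subsetI)
  fix v assume "v \<in> {v. length v = d \<and> newton_poly v d = p}"
  then have "length v = d" "newton_poly v d = newton_poly w d" using w by auto
  then have "(\<Prod>a\<leftarrow>v. [:- a, 1:]) = (\<Prod>a\<leftarrow>w. [:- a, 1:])"
    using w by (simp add: newton_poly_def)
  then have "mset v = mset w" by (rule linear_factors_determine_mset)
  then obtain \<sigma> where "\<sigma> permutes {..<length w}" "permute_list \<sigma> w = v"
    by (rule mset_eq_permutation)
  then show "v \<in> (\<lambda>\<sigma>. permute_list \<sigma> w) ` {\<sigma>. \<sigma> permutes {..<d}}" using w by auto
next
  fix v assume "v \<in> (\<lambda>\<sigma>. permute_list \<sigma> w) ` {\<sigma>. \<sigma> permutes {..<d}}"
  then obtain \<sigma> where \<sigma>: "\<sigma> permutes {..<length w}" "v = permute_list \<sigma> w" using w by auto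
  have "mset (map (\<lambda>a. [:- a, 1:]) v) = mset (map (\<lambda>a. [:- a, 1:]) w)"
    using \<sigma> by (simp only: mset_map mset_permute_list)
  then have "(\<Prod>a\<leftarrow>v. [:- a, 1:]) = (\<Prod>a\<leftarrow>w. [:- a, 1:])"
    by (metis prod_mset_prod_list)
  then show "v \<in> {v. length v = d \<and> newton_poly v d = p}"
    using w \<sigma> by (simp add: newton_poly_def)
qed

lemma prony_solutions_eq_permutations:
  assumes d: "d \<ge> 1" and \<mu>: "\<mu> \<in> hankel_regular d"
    and w: "length w = d" "newton_poly w d = node_poly d \<mu>"
  shows "prony_solutions d \<mu> = (\<lambda>\<sigma>. prony_vector d \<mu> (permute_list \<sigma> w)) ` {\<sigma>. \<sigma> permutes {..<d}}"
  unfolding prony_solutions_eq[OF d \<mu>] prony_vector_def[symmetric] node_lists_eq_permutations[OF w]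
  by (simp add: image_image)

text \<open>
  Near \<open>\<mu>\<close> the roots are listed as \<open>W \<nu>\<close>, converging to a fixed listing \<open>w\<close> at \<open>\<mu>\<close>.  A permutation \<open>\<sigma>\<close>
  pairs the solution of \<open>\<sigma> w\<close> with that of \<open>\<sigma> (W \<nu>)\<close>; these pairs exhaust both solution sets,
  which bounds both halves of the Hausdorff distance at once.
\<close>

lemma prony_solutions_continuous:
  assumes d: "d \<ge> 1" and U: "U \<subseteq> hankel_regular d"
  shows "continuous_multivalued_on U (prony_solutions d)"
proof -
  let ?Perm = "{\<sigma>. \<sigma> permutes {..<d}}"
  have finPerm: "finite ?Perm" by (rule finite_permutations) simp
  have nePerm: "?Perm \<noteq> {}" using permutes_id by blast
  have key: "finite (prony_solutions d \<mu>) \<and> prony_solutions d \<mu> \<noteq> {} \<and>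
      (\<forall>\<epsilon>>0. \<exists>\<eta>>0. \<forall>\<nu>\<in>U. vec_dist \<mu> \<nu> < \<eta> \<longrightarrow>
        hausdorff_dist (prony_solutions d \<mu>) (prony_solutions d \<nu>) < \<epsilon>)" if \<mu>U: "\<mu> \<in> U" for \<mu>
  proof -
    have \<mu>: "\<mu> \<in> hankel_regular d" "length \<mu> = 2 * d" using \<mu>U U by (auto simp: hankel_regular_iff)
    obtain w where w: "length w = d" "(\<Prod>a\<leftarrow>w. [:- a, 1:]) = node_poly d \<mu>"
      using fundamental_theorem_algebra_factorized[of "node_poly d \<mu>"] node_poly_monic[of d \<mu>] by auto
    have "\<exists>W. (\<forall>\<nu>. length (W \<nu>) = length w \<and> node_poly d \<nu> = (\<Prod>a\<leftarrow>W \<nu>. [:- a, 1:])) \<and>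
        (\<forall>i<length w. ((\<lambda>\<nu>. W \<nu> ! i) \<longlongrightarrow> w ! i) (vec_nhds \<mu>))"
      by (rule roots_tendsto)
        (use w node_poly_monic node_poly_coeff_tendsto[OF \<mu>(1)] in auto)
    then obtain W where roots: "\<And>\<nu>. length (W \<nu>) = length w \<and> node_poly d \<nu> = (\<Prod>a\<leftarrow>W \<nu>. [:- a, 1:])"
      and lim: "\<And>i. i < length w \<Longrightarrow> ((\<lambda>\<nu>. W \<nu> ! i) \<longlongrightarrow> w ! i) (vec_nhds \<mu>)" by blast
    have W: "length (W \<nu>) = d" "newton_poly (W \<nu>) d = node_poly d \<nu>" for \<nu>
      using roots[of \<nu>] w(1) by (auto simp: newton_poly_def)
    have sol\<mu>: "prony_solutions d \<mu> = (\<lambda>\<sigma>. prony_vector d \<mu> (permute_list \<sigma> w)) ` ?Perm"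
      by (rule prony_solutions_eq_permutations[OF d \<mu>(1)]) (use w in \<open>auto simp: newton_poly_def\<close>)
    have sol\<nu>: "prony_solutions d \<nu> = (\<lambda>\<sigma>. prony_vector d \<nu> (permute_list \<sigma> (W \<nu>))) ` ?Perm"
      if "\<nu> \<in> U" for \<nu>
      by (rule prony_solutions_eq_permutations[OF d]) (use that U W in auto)
    have close: "((\<lambda>\<nu>. vec_dist (prony_vector d \<mu> (permute_list \<sigma> w))
        (prony_vector d \<nu> (permute_list \<sigma> (W \<nu>)))) \<longlongrightarrow> 0) (vec_nhds \<mu>)" if \<sigma>: "\<sigma> \<in> ?Perm" for \<sigma>
    proof (rule prony_vector_tendsto)
      fix i assume i: "i < d"
      then have "\<sigma> i < d" using \<sigma> permutes_in_image[of \<sigma> "{..<d}" i] by auto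
      then show "((\<lambda>\<nu>. permute_list \<sigma> (W \<nu>) ! i) \<longlongrightarrow> permute_list \<sigma> w ! i) (vec_nhds \<mu>)"
        using lim[of "\<sigma> i"] i \<sigma> w(1) W(1) by (simp add: permute_list_nth)
    qed (use \<mu> w W in auto)
    have "\<exists>\<eta>>0. \<forall>\<nu>\<in>U. vec_dist \<mu> \<nu> < \<eta> \<longrightarrow>
        hausdorff_dist (prony_solutions d \<mu>) (prony_solutions d \<nu>) < \<epsilon>" if \<epsilon>: "\<epsilon> > 0" for \<epsilon>
    proof -
      have "eventually (\<lambda>\<nu>. \<forall>\<sigma>\<in>?Perm. vec_dist (prony_vector d \<mu> (permute_list \<sigma> w))
          (prony_vector d \<nu> (permute_list \<sigma> (W \<nu>))) < \<epsilon>) (vec_nhds \<mu>)"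
        using finPerm close \<epsilon> by (intro eventually_ball_finite) (auto dest: order_tendstoD(2))
      then obtain \<eta> where \<eta>: "\<eta> > 0"
        and near: "\<And>\<nu> \<sigma>. length \<nu> = length \<mu> \<Longrightarrow> vec_dist \<mu> \<nu> < \<eta> \<Longrightarrow> \<sigma> \<in> ?Perm \<Longrightarrow>
          vec_dist (prony_vector d \<mu> (permute_list \<sigma> w)) (prony_vector d \<nu> (permute_list \<sigma> (W \<nu>))) < \<epsilon>"
        unfolding eventually_vec_nhds by blast
      have "hausdorff_dist (prony_solutions d \<mu>) (prony_solutions d \<nu>) < \<epsilon>"
        if \<nu>: "\<nu> \<in> U" "vec_dist \<mu> \<nu> < \<eta>" for \<nu>
      proof -
        have "length \<nu> = length \<mu>" using \<nu>(1) U \<mu>(2) by (auto simp: hankel_regular_iff)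
        note near = near[OF this \<nu>(2)]
        show ?thesis
          unfolding sol\<mu> sol\<nu>[OF \<nu>(1)]
          by (rule hausdorff_dist_less) (use near finPerm nePerm in blast)+
      qed
      then show ?thesis using \<eta> by blast
    qed
    then show ?thesis using sol\<mu> finPerm nePerm by simp
  qed
  then show ?thesis unfolding continuous_multivalued_on_def by blast
qed

lemma hankel_regular_open:
  assumes \<mu>: "\<mu> \<in> hankel_regular d"
  shows "\<exists>r>0. vec_ball (2 * d) \<mu> r \<subseteq> hankel_regular d"
proof -
  have "((\<lambda>\<nu>. Determinant.det (hankel d \<nu>)) \<longlongrightarrow> Determinant.det (hankel d \<mu>)) (vec_nhds \<mu>)"
    using \<mu> by (intro tendsto_coord_polynomial[OF coord_polynomial_det_hankel])
      (simp add: hankel_regular_iff)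
  then have "eventually (\<lambda>\<nu>. Determinant.det (hankel d \<nu>) \<noteq> 0) (vec_nhds \<mu>)"
    by (rule tendsto_imp_eventually_ne) (use \<mu> in \<open>simp add: hankel_regular_iff\<close>)
  then obtain \<eta> where "\<eta> > 0" "\<And>\<nu>. length \<nu> = length \<mu> \<Longrightarrow> vec_dist \<mu> \<nu> < \<eta> \<Longrightarrow>
      Determinant.det (hankel d \<nu>) \<noteq> 0"
    unfolding eventually_vec_nhds by blast
  then show ?thesis
    using \<mu> by (intro exI[of _ \<eta>]) (auto simp: hankel_regular_iff vec_ball_def)
qed

section \<open>Algebraicity of the solutions\<close>

text \<open>
  The equations \<open>D(\<mu>) Q\<^sub>\<mu>(x\<^sub>i) = 0\<close>, cleared of denominators so that only polynomials in \<open>\<mu>\<close> occur.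
\<close>

definition node_relations :: "nat \<Rightarrow> (complex list \<times> complex list) set" where
  "node_relations d = {(\<mu>, w). length w = d \<and> (\<forall>i<d.
     Determinant.det (hankel d \<mu>) * w ! i ^ d = - (\<Sum>k<d. hankel_numerator d \<mu> k * w ! i ^ k))}"

text \<open>
  Exponent vectors of the monomials that generate the module; functions on \<open>{..<d}\<close> rather than lists,
  so that changing one exponent is a function update.
\<close>

definition exponents :: "nat \<Rightarrow> (nat \<Rightarrow> nat) set" where
  "exponents d = {..<d} \<rightarrow>\<^sub>E {..<d}"

definition node_monomial :: "nat \<Rightarrow> (nat \<Rightarrow> nat) \<Rightarrow> complex list \<Rightarrow> complex" where
  "node_monomial d \<alpha> w = (\<Prod>i<d. w ! i ^ \<alpha> i)"

text \<open>
  After multiplication by a power of \<open>D\<close>, multiplication by \<open>f\<close> is given on the generating monomials by a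
  matrix of polynomials in \<open>\<mu>\<close>.  Such functions form a ring, and each of them is a root of a
  characteristic polynomial.  Allowing powers of \<open>D\<close> here avoids a ring of fractions.
\<close>

definition acts_on_monomials :: "nat \<Rightarrow> (complex list \<Rightarrow> complex list \<Rightarrow> complex) \<Rightarrow> bool" where
  "acts_on_monomials d f \<longleftrightarrow> (\<exists>K M.
     (\<forall>\<alpha>\<in>exponents d. \<forall>\<beta>\<in>exponents d. coord_polynomial (2 * d) (M \<alpha> \<beta>)) \<and>
     (\<forall>\<mu> w. (\<mu>, w) \<in> node_relations d \<longrightarrow> (\<forall>\<alpha>\<in>exponents d.
        Determinant.det (hankel d \<mu>) ^ K * f \<mu> w * node_monomial d \<alpha> w
        = (\<Sum>\<beta>\<in>exponents d. M \<alpha> \<beta> \<mu> * node_monomial d \<beta> w))))"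

lemma finite_exponents [simp]: "finite (exponents d)"
  by (simp add: exponents_def finite_PiE)

lemma acts_on_monomialsI:
  assumes "\<And>\<alpha> \<beta>. \<alpha> \<in> exponents d \<Longrightarrow> \<beta> \<in> exponents d \<Longrightarrow> coord_polynomial (2 * d) (M \<alpha> \<beta>)"
    and "\<And>\<mu> w \<alpha>. (\<mu>, w) \<in> node_relations d \<Longrightarrow> \<alpha> \<in> exponents d \<Longrightarrow>
        Determinant.det (hankel d \<mu>) ^ K * f \<mu> w * node_monomial d \<alpha> w
        = (\<Sum>\<beta>\<in>exponents d. M \<alpha> \<beta> \<mu> * node_monomial d \<beta> w)"
  shows "acts_on_monomials d f"
  unfolding acts_on_monomials_def using assms by (intro exI[of _ K] exI[of _ M]) auto

lemma acts_on_monomialsE: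
  assumes "acts_on_monomials d f"
  obtains K M where
    "\<And>\<alpha> \<beta>. \<alpha> \<in> exponents d \<Longrightarrow> \<beta> \<in> exponents d \<Longrightarrow> coord_polynomial (2 * d) (M \<alpha> \<beta>)"
    "\<And>\<mu> w \<alpha>. (\<mu>, w) \<in> node_relations d \<Longrightarrow> \<alpha> \<in> exponents d \<Longrightarrow>
        Determinant.det (hankel d \<mu>) ^ K * f \<mu> w * node_monomial d \<alpha> w
        = (\<Sum>\<beta>\<in>exponents d. M \<alpha> \<beta> \<mu> * node_monomial d \<beta> w)"
proof -
  obtain K M where
    "\<forall>\<alpha>\<in>exponents d. \<forall>\<beta>\<in>exponents d. coord_polynomial (2 * d) (M \<alpha> \<beta>)"
    "\<forall>\<mu> w. (\<mu>, w) \<in> node_relations d \<longrightarrow> (\<forall>\<alpha>\<in>exponents d.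
        Determinant.det (hankel d \<mu>) ^ K * f \<mu> w * node_monomial d \<alpha> w
        = (\<Sum>\<beta>\<in>exponents d. M \<alpha> \<beta> \<mu> * node_monomial d \<beta> w))"
    using assms unfolding acts_on_monomials_def by (elim exE conjE)
  then show ?thesis by (intro that[of M K]) blast+
qed

lemma acts_on_monomials_cong:
  assumes "acts_on_monomials d f" "\<And>\<mu> w. (\<mu>, w) \<in> node_relations d \<Longrightarrow> f \<mu> w = g \<mu> w"
  shows "acts_on_monomials d g"
proof -
  from assms(1) obtain K M where
    "\<And>\<alpha> \<beta>. \<alpha> \<in> exponents d \<Longrightarrow> \<beta> \<in> exponents d \<Longrightarrow> coord_polynomial (2 * d) (M \<alpha> \<beta>)"
    "\<And>\<mu> w \<alpha>. (\<mu>, w) \<in> node_relations d \<Longrightarrow> \<alpha> \<in> exponents d \<Longrightarrow>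
        Determinant.det (hankel d \<mu>) ^ K * f \<mu> w * node_monomial d \<alpha> w
        = (\<Sum>\<beta>\<in>exponents d. M \<alpha> \<beta> \<mu> * node_monomial d \<beta> w)"
    by (rule acts_on_monomialsE) blast
  then show ?thesis using assms(2) by (intro acts_on_monomialsI[of d M K]) auto
qed

lemma acts_on_monomials_coord_polynomial:
  assumes p: "coord_polynomial (2 * d) p"
  shows "acts_on_monomials d (\<lambda>\<mu> w. p \<mu>)"
proof (rule acts_on_monomialsI[of d "\<lambda>\<alpha> \<beta> \<mu>. (if \<alpha> = \<beta> then 1 else 0) * p \<mu>" 0])
  fix \<mu> w \<alpha> assume "\<alpha> \<in> exponents d"
  have "(\<Sum>\<beta>\<in>exponents d. (if \<alpha> = \<beta> then 1 else 0) * p \<mu> * node_monomial d \<beta> w)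
      = (\<Sum>\<beta>\<in>exponents d. if \<alpha> = \<beta> then p \<mu> * node_monomial d \<beta> w else 0)"
    by (rule sum.cong) auto
  then show "Determinant.det (hankel d \<mu>) ^ 0 * p \<mu> * node_monomial d \<alpha> w
      = (\<Sum>\<beta>\<in>exponents d. (if \<alpha> = \<beta> then 1 else 0) * p \<mu> * node_monomial d \<beta> w)"
    using \<open>\<alpha> \<in> exponents d\<close> by simp
qed (intro coord_polynomial.mult coord_polynomial.const p)

lemma acts_on_monomials_add:
  assumes f: "acts_on_monomials d f" and g: "acts_on_monomials d g"
  shows "acts_on_monomials d (\<lambda>\<mu> w. f \<mu> w + g \<mu> w)"
proof -
  let ?D = "\<lambda>\<mu>. Determinant.det (hankel d \<mu>)"
  obtain K M where M:
    "\<And>\<alpha> \<beta>. \<alpha> \<in> exponents d \<Longrightarrow> \<beta> \<in> exponents d \<Longrightarrow> coord_polynomial (2 * d) (M \<alpha> \<beta>)"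
    "\<And>\<mu> w \<alpha>. (\<mu>, w) \<in> node_relations d \<Longrightarrow> \<alpha> \<in> exponents d \<Longrightarrow>
        ?D \<mu> ^ K * f \<mu> w * node_monomial d \<alpha> w = (\<Sum>\<beta>\<in>exponents d. M \<alpha> \<beta> \<mu> * node_monomial d \<beta> w)"
    using f by (rule acts_on_monomialsE) blast
  obtain L N where N:
    "\<And>\<alpha> \<beta>. \<alpha> \<in> exponents d \<Longrightarrow> \<beta> \<in> exponents d \<Longrightarrow> coord_polynomial (2 * d) (N \<alpha> \<beta>)"
    "\<And>\<mu> w \<alpha>. (\<mu>, w) \<in> node_relations d \<Longrightarrow> \<alpha> \<in> exponents d \<Longrightarrow>
        ?D \<mu> ^ L * g \<mu> w * node_monomial d \<alpha> w = (\<Sum>\<beta>\<in>exponents d. N \<alpha> \<beta> \<mu> * node_monomial d \<beta> w)"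
    using g by (rule acts_on_monomialsE) blast
  show ?thesis
  proof (rule acts_on_monomialsI[of d "\<lambda>\<alpha> \<beta> \<mu>. ?D \<mu> ^ L * M \<alpha> \<beta> \<mu> + ?D \<mu> ^ K * N \<alpha> \<beta> \<mu>" "K + L"])
    fix \<mu> w \<alpha> assume R: "(\<mu>, w) \<in> node_relations d" "\<alpha> \<in> exponents d"
    have "?D \<mu> ^ (K + L) * (f \<mu> w + g \<mu> w) * node_monomial d \<alpha> w
        = ?D \<mu> ^ L * (?D \<mu> ^ K * f \<mu> w * node_monomial d \<alpha> w)
          + ?D \<mu> ^ K * (?D \<mu> ^ L * g \<mu> w * node_monomial d \<alpha> w)"
      by (simp add: power_add algebra_simps)
    also have "\<dots> = (\<Sum>\<beta>\<in>exponents d. (?D \<mu> ^ L * M \<alpha> \<beta> \<mu> + ?D \<mu> ^ K * N \<alpha> \<beta> \<mu>) * node_monomial d \<beta> w)"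
      unfolding M(2)[OF R] N(2)[OF R] by (simp add: sum_distrib_left sum.distrib algebra_simps)
    finally show "?D \<mu> ^ (K + L) * (f \<mu> w + g \<mu> w) * node_monomial d \<alpha> w = \<dots>" .
  qed (intro coord_polynomial.intros coord_polynomial_power coord_polynomial_det_hankel M N)
qed

lemma acts_on_monomials_mult:
  assumes f: "acts_on_monomials d f" and g: "acts_on_monomials d g"
  shows "acts_on_monomials d (\<lambda>\<mu> w. f \<mu> w * g \<mu> w)"
proof -
  let ?D = "\<lambda>\<mu>. Determinant.det (hankel d \<mu>)"
  obtain K M where M:
    "\<And>\<alpha> \<beta>. \<alpha> \<in> exponents d \<Longrightarrow> \<beta> \<in> exponents d \<Longrightarrow> coord_polynomial (2 * d) (M \<alpha> \<beta>)"
    "\<And>\<mu> w \<alpha>. (\<mu>, w) \<in> node_relations d \<Longrightarrow> \<alpha> \<in> exponents d \<Longrightarrow>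
        ?D \<mu> ^ K * f \<mu> w * node_monomial d \<alpha> w = (\<Sum>\<beta>\<in>exponents d. M \<alpha> \<beta> \<mu> * node_monomial d \<beta> w)"
    using f by (rule acts_on_monomialsE) blast
  obtain L N where N:
    "\<And>\<alpha> \<beta>. \<alpha> \<in> exponents d \<Longrightarrow> \<beta> \<in> exponents d \<Longrightarrow> coord_polynomial (2 * d) (N \<alpha> \<beta>)"
    "\<And>\<mu> w \<alpha>. (\<mu>, w) \<in> node_relations d \<Longrightarrow> \<alpha> \<in> exponents d \<Longrightarrow>
        ?D \<mu> ^ L * g \<mu> w * node_monomial d \<alpha> w = (\<Sum>\<beta>\<in>exponents d. N \<alpha> \<beta> \<mu> * node_monomial d \<beta> w)"
    using g by (rule acts_on_monomialsE) blast
  show ?thesis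
  proof (rule acts_on_monomialsI[of d "\<lambda>\<alpha> \<beta> \<mu>. \<Sum>\<gamma>\<in>exponents d. M \<alpha> \<gamma> \<mu> * N \<gamma> \<beta> \<mu>" "K + L"])
    fix \<mu> w \<alpha> assume R: "(\<mu>, w) \<in> node_relations d" "\<alpha> \<in> exponents d"
    have "?D \<mu> ^ (K + L) * (f \<mu> w * g \<mu> w) * node_monomial d \<alpha> w
        = ?D \<mu> ^ L * g \<mu> w * (?D \<mu> ^ K * f \<mu> w * node_monomial d \<alpha> w)"
      by (simp add: power_add mult_ac)
    also have "\<dots> = (\<Sum>\<gamma>\<in>exponents d. M \<alpha> \<gamma> \<mu> * (?D \<mu> ^ L * g \<mu> w * node_monomial d \<gamma> w))"
      unfolding M(2)[OF R] by (simp add: sum_distrib_left mult_ac)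
    also have "\<dots> = (\<Sum>\<gamma>\<in>exponents d. M \<alpha> \<gamma> \<mu> * (\<Sum>\<beta>\<in>exponents d. N \<gamma> \<beta> \<mu> * node_monomial d \<beta> w))"
      by (rule sum.cong[OF refl]) (simp only: N(2)[OF R(1)])
    also have "\<dots> = (\<Sum>\<beta>\<in>exponents d. (\<Sum>\<gamma>\<in>exponents d. M \<alpha> \<gamma> \<mu> * N \<gamma> \<beta> \<mu>) * node_monomial d \<beta> w)"
      unfolding sum_distrib_left sum_distrib_right by (subst sum.swap) (simp only: mult.assoc)
    finally show "?D \<mu> ^ (K + L) * (f \<mu> w * g \<mu> w) * node_monomial d \<alpha> w = \<dots>" .
  qed (intro coord_polynomial_sum coord_polynomial.mult M N)
qed

lemma acts_on_monomials_sum: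
  assumes "\<And>i. i \<in> I \<Longrightarrow> acts_on_monomials d (f i)"
  shows "acts_on_monomials d (\<lambda>\<mu> w. \<Sum>i\<in>I. f i \<mu> w)"
  using assms
  by (induction I rule: infinite_finite_induct)
    (auto intro: acts_on_monomials_add acts_on_monomials_coord_polynomial coord_polynomial.const)

lemma node_monomial_update:
  assumes "i < d"
  shows "node_monomial d (\<alpha>(i := k)) w = w ! i ^ k * (\<Prod>j\<in>{..<d} - {i}. w ! j ^ \<alpha> j)"
proof -
  have "node_monomial d (\<alpha>(i := k)) w
      = w ! i ^ (\<alpha>(i := k)) i * (\<Prod>j\<in>{..<d} - {i}. w ! j ^ (\<alpha>(i := k)) j)"
    unfolding node_monomial_def by (rule prod.remove) (use assms in auto)
  also have "(\<Prod>j\<in>{..<d} - {i}. w ! j ^ (\<alpha>(i := k)) j) = (\<Prod>j\<in>{..<d} - {i}. w ! j ^ \<alpha> j)"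
    by (rule prod.cong) auto
  finally show ?thesis unfolding fun_upd_same .
qed

text \<open>
  Multiplication by \<open>x\<^sub>i\<close> raises the \<open>i\<close>-th exponent; if that exponent was \<open>d - 1\<close>, the relation for \<open>x\<^sub>i\<close> reduces
  \<open>D x\<^sub>i\<^sup>d\<close> to lower powers.  The matrix entry sums over the possible new exponents \<open>k\<close>, with coefficient
  \<open>C (\<alpha> i) k\<close>.
\<close>

lemma acts_on_monomials_node:
  assumes i: "i < d"
  shows "acts_on_monomials d (\<lambda>\<mu> w. w ! i)"
proof -
  let ?D = "\<lambda>\<mu>. Determinant.det (hankel d \<mu>)"
  define C where "C a k \<mu> = (if Suc a < d then (if k = Suc a then ?D \<mu> else 0)
    else - hankel_numerator d \<mu> k)" for a k \<mu>
  have C: "coord_polynomial (2 * d) (C a k)" if "k < d" for a k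
    using that unfolding C_def[abs_def]
    by (cases "Suc a < d"; cases "k = Suc a")
      (auto intro: coord_polynomial.const coord_polynomial_det_hankel coord_polynomial_uminus
        coord_polynomial_hankel_numerator)
  show ?thesis
  proof (rule acts_on_monomialsI[of d "\<lambda>\<alpha> \<beta> \<mu>. \<Sum>k<d. (if \<beta> = \<alpha>(i := k) then 1 else 0) * C (\<alpha> i) k \<mu>" 1])
    fix \<mu> w \<alpha> assume R: "(\<mu>, w) \<in> node_relations d" and \<alpha>: "\<alpha> \<in> exponents d"
    let ?R = "\<Prod>j\<in>{..<d} - {i}. w ! j ^ \<alpha> j"
    have \<alpha>i: "\<alpha> i < d" using \<alpha> i by (auto simp: exponents_def)
    have upd: "\<alpha>(i := k) \<in> exponents d" if "k < d" for k
      using \<alpha> that i by (auto simp: exponents_def PiE_iff extensional_def)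
    have one: "?D \<mu> * w ! i ^ Suc (\<alpha> i) = (\<Sum>k<d. C (\<alpha> i) k \<mu> * w ! i ^ k)"
    proof (cases "Suc (\<alpha> i) < d")
      case True
      have "(\<Sum>k<d. C (\<alpha> i) k \<mu> * w ! i ^ k)
          = (\<Sum>k<d. if k = Suc (\<alpha> i) then ?D \<mu> * w ! i ^ Suc (\<alpha> i) else 0)"
        by (rule sum.cong) (use True in \<open>auto simp: C_def\<close>)
      then show ?thesis using True by simp
    next
      case False
      then have "Suc (\<alpha> i) = d" using \<alpha>i by simp
      then show ?thesis using R i False unfolding node_relations_def
        by (simp add: C_def sum_negf)
    qed
    have "?D \<mu> ^ 1 * w ! i * node_monomial d \<alpha> w = (?D \<mu> * w ! i ^ Suc (\<alpha> i)) * ?R"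
      using node_monomial_update[OF i, of \<alpha> "\<alpha> i" w] by (simp add: mult_ac)
    also have "\<dots> = (\<Sum>k<d. C (\<alpha> i) k \<mu> * node_monomial d (\<alpha>(i := k)) w)"
      unfolding one node_monomial_update[OF i] by (simp add: sum_distrib_right mult.assoc)
    also have "\<dots> = (\<Sum>k<d. \<Sum>\<beta>\<in>exponents d.
        if \<beta> = \<alpha>(i := k) then C (\<alpha> i) k \<mu> * node_monomial d \<beta> w else 0)"
      by (rule sum.cong[OF refl]) (use upd in simp)
    also have "\<dots> = (\<Sum>k<d. \<Sum>\<beta>\<in>exponents d.
        (if \<beta> = \<alpha>(i := k) then 1 else 0) * C (\<alpha> i) k \<mu> * node_monomial d \<beta> w)"
      by (intro sum.cong refl) simp
    also have "\<dots> = (\<Sum>\<beta>\<in>exponents d. (\<Sum>k<d. (if \<beta> = \<alpha>(i := k) then 1 else 0) * C (\<alpha> i) k \<mu>)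
        * node_monomial d \<beta> w)"
      unfolding sum_distrib_right by (rule sum.swap)
    finally show "?D \<mu> ^ 1 * w ! i * node_monomial d \<alpha> w = \<dots>" .
  qed (intro coord_polynomial_sum coord_polynomial.mult coord_polynomial.const C, simp)
qed

lemma acts_on_monomials_newton_coeff:
  "j \<le> d \<Longrightarrow> acts_on_monomials d (\<lambda>\<mu> w. coeff (newton_poly w j) k)"
proof (induction j arbitrary: k)
  case 0
  then show ?case by (simp add: acts_on_monomials_coord_polynomial coord_polynomial.const)
next
  case (Suc j)
  have "acts_on_monomials d (\<lambda>\<mu> w. (case k of 0 \<Rightarrow> 0 | Suc i \<Rightarrow> coeff (newton_poly w j) i)
      + (- 1) * (w ! j * coeff (newton_poly w j) k))"
  proof (intro acts_on_monomials_add acts_on_monomials_mult)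
    show "acts_on_monomials d (\<lambda>\<mu> w. case k of 0 \<Rightarrow> 0 | Suc i \<Rightarrow> coeff (newton_poly w j) i)"
      using Suc by (cases k) (auto intro: acts_on_monomials_coord_polynomial coord_polynomial.const)
  qed (use Suc in \<open>auto intro: acts_on_monomials_node acts_on_monomials_coord_polynomial coord_polynomial.const\<close>)
  then show ?case
  proof (rule acts_on_monomials_cong)
    fix \<mu> w assume "(\<mu>, w) \<in> node_relations d"
    then have "newton_poly w (Suc j) = [:- (w ! j), 1:] * newton_poly w j"
      using Suc.prems by (intro newton_poly_Suc) (simp add: node_relations_def)
    then show "(case k of 0 \<Rightarrow> 0 | Suc i \<Rightarrow> coeff (newton_poly w j) i)
        + (- 1) * (w ! j * coeff (newton_poly w j) k) = coeff (newton_poly w (Suc j)) k"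
      by (simp only: coeff_mult_linear mult_minus1 diff_conv_add_uminus)
  qed
qed

lemma acts_on_monomials_prony_vector:
  assumes i: "i < 2 * d"
  shows "acts_on_monomials d (\<lambda>\<mu> w. prony_vector d \<mu> w ! i)"
proof (cases "i < d")
  case True
  show ?thesis
    by (rule acts_on_monomials_cong[OF acts_on_monomials_node[OF True]])
      (use True i in \<open>auto simp: node_relations_def prony_vector_nth\<close>)
next
  case False
  have "acts_on_monomials d (\<lambda>\<mu> w. \<Sum>k\<le>i - d. coeff (newton_poly w (i - d)) k * \<mu> ! k)"
    by (intro acts_on_monomials_sum acts_on_monomials_mult acts_on_monomials_newton_coeff
        acts_on_monomials_coord_polynomial coord_polynomial.coord) (use i in auto)
  then show ?thesis
    by (rule acts_on_monomials_cong) (use False i in \<open>auto simp: node_relations_def prony_vector_nth\<close>)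
qed

lemma coord_polynomial_char_poly_coeff:
  assumes dim: "\<And>x. A x \<in> carrier_mat k k"
    and entry: "\<And>i j. i < k \<Longrightarrow> j < k \<Longrightarrow> coord_polynomial n (\<lambda>x. A x $$ (i, j))"
  shows "coord_polynomial n (\<lambda>x. coeff (char_poly (A x)) l)"
proof -
  let ?P = "\<lambda>X :: complex list \<Rightarrow> complex poly. \<forall>l. coord_polynomial n (\<lambda>x. coeff (X x) l)"
  have "?P (\<lambda>x. Determinant.det (char_poly_matrix (A x)))"
  proof (rule closed_under_det[where P = ?P])
    fix i j assume ij: "i < k" "j < k"
    have "char_poly_matrix (A x) $$ (i, j) = (if i = j then [:0, 1:] else 0) + [:- (A x $$ (i, j)):]" for x
      using dim[of x] ij by (auto simp: char_poly_matrix_def)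
    moreover have "coord_polynomial n (\<lambda>x. coeff [:- (A x $$ (i, j)):] l)" for l
      using entry[OF ij] by (cases l) (auto intro: coord_polynomial_uminus coord_polynomial.const)
    ultimately show "?P (\<lambda>x. char_poly_matrix (A x) $$ (i, j))"
      by (auto intro!: coord_polynomial.add coord_polynomial.const)
  next
    fix f g :: "complex list \<Rightarrow> complex poly" assume "?P f" "?P g"
    then show "?P (\<lambda>x. f x * g x)"
      by (auto simp: coeff_mult intro!: coord_polynomial_sum coord_polynomial.mult)
  qed (use dim in \<open>auto intro: coord_polynomial.intros\<close>)
  then show ?thesis by (simp add: char_poly_def)
qed

text \<open>
  The vector of monomials is a nonzero eigenvector (it contains the constant monomial \<open>1\<close>) of the
  matrix \<open>A\<close> for the eigenvalue \<open>D\<^sup>K f\<close>.  Inserting this eigenvalue into the monic characteristic polynomial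
  gives an equation for \<open>f\<close> with leading coefficient a power of \<open>D\<close>.
\<close>

lemma acts_on_monomials_algebraic:
  assumes d: "d \<ge> 1" and f: "acts_on_monomials d f"
  shows "\<exists>N c. (\<forall>j\<le>N. coord_polynomial (2 * d) (c j)) \<and>
    (\<forall>\<mu>. Determinant.det (hankel d \<mu>) \<noteq> 0 \<longrightarrow> c N \<mu> \<noteq> 0) \<and>
    (\<forall>\<mu> w. (\<mu>, w) \<in> node_relations d \<longrightarrow> (\<Sum>j\<le>N. c j \<mu> * f \<mu> w ^ j) = 0)"
proof -
  let ?D = "\<lambda>\<mu>. Determinant.det (hankel d \<mu>)"
  obtain K M where M:
    "\<And>\<alpha> \<beta>. \<alpha> \<in> exponents d \<Longrightarrow> \<beta> \<in> exponents d \<Longrightarrow> coord_polynomial (2 * d) (M \<alpha> \<beta>)"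
    "\<And>\<mu> w \<alpha>. (\<mu>, w) \<in> node_relations d \<Longrightarrow> \<alpha> \<in> exponents d \<Longrightarrow>
        ?D \<mu> ^ K * f \<mu> w * node_monomial d \<alpha> w = (\<Sum>\<beta>\<in>exponents d. M \<alpha> \<beta> \<mu> * node_monomial d \<beta> w)"
    using f by (rule acts_on_monomialsE) blast
  define N where "N = card (exponents d)"
  obtain h where h: "bij_betw h {0..<N} (exponents d)"
    unfolding N_def using ex_bij_betw_nat_finite[OF finite_exponents] by blast
  have h_in: "h a \<in> exponents d" if "a < N" for a
    using bij_betwE[OF h] that by auto
  define A where "A \<mu> = Matrix.mat N N (\<lambda>(a, b). M (h a) (h b) \<mu>)" for \<mu>
  define v where "v w = Matrix.vec N (\<lambda>a. node_monomial d (h a) w)" for w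
  define c where "c j \<mu> = coeff (char_poly (A \<mu>)) j * (?D \<mu> ^ K) ^ j" for j \<mu>
  have A: "A \<mu> \<in> carrier_mat N N" for \<mu> by (simp add: A_def)
  have "coord_polynomial (2 * d) (\<lambda>\<mu>. coeff (char_poly (A \<mu>)) j)" for j
    by (rule coord_polynomial_char_poly_coeff[OF A]) (simp add: A_def M h_in)
  then have c_poly: "coord_polynomial (2 * d) (c j)" for j
    unfolding c_def[abs_def]
    by (intro coord_polynomial.mult coord_polynomial_power coord_polynomial_det_hankel)
  have c_top: "c N \<mu> \<noteq> 0" if "?D \<mu> \<noteq> 0" for \<mu>
    using that degree_monic_char_poly[OF A, of \<mu>] by (simp add: c_def)
  have c_root: "(\<Sum>j\<le>N. c j \<mu> * f \<mu> w ^ j) = 0" if R: "(\<mu>, w) \<in> node_relations d" for \<mu> w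
  proof -
    let ?e = "?D \<mu> ^ K * f \<mu> w"
    have "eigenvector (A \<mu>) (v w) ?e"
      unfolding eigenvector_def
    proof (intro conjI)
      show "v w \<in> carrier_vec (dim_row (A \<mu>))" by (simp add: v_def A_def)
      have "(\<lambda>i\<in>{..<d}. 0) \<in> exponents d" using d by (auto simp: exponents_def)
      then have "(\<lambda>i\<in>{..<d}. 0) \<in> h ` {0..<N}" by (simp only: bij_betw_imp_surj_on[OF h])
      then obtain a where "(\<lambda>i\<in>{..<d}. 0) = h a" "a \<in> {0..<N}" by (rule imageE)
      then have a: "a < N" "h a = (\<lambda>i\<in>{..<d}. 0)" by simp_all
      then have "v w $ a = 1" by (simp add: v_def node_monomial_def)
      then show "v w \<noteq> 0\<^sub>v (dim_row (A \<mu>))" using a by (auto simp: A_def)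
      show "A \<mu> *\<^sub>v v w = ?e \<cdot>\<^sub>v v w"
      proof (rule eq_vecI)
        fix a assume "a < dim_vec (?e \<cdot>\<^sub>v v w)"
        then have a: "a < N" by (simp add: v_def)
        have "(A \<mu> *\<^sub>v v w) $ a = (\<Sum>b\<in>{0..<N}. M (h a) (h b) \<mu> * node_monomial d (h b) w)"
          using a by (simp add: A_def v_def scalar_prod_def)
        also have "\<dots> = (\<Sum>\<beta>\<in>exponents d. M (h a) \<beta> \<mu> * node_monomial d \<beta> w)"
          by (rule sum.reindex_bij_betw[OF h])
        also have "\<dots> = ?e * node_monomial d (h a) w" by (rule M(2)[OF R h_in[OF a], symmetric])
        finally show "(A \<mu> *\<^sub>v v w) $ a = (?e \<cdot>\<^sub>v v w) $ a" using a by (simp add: v_def)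
      qed (simp add: A_def v_def)
    qed
    then have "poly (char_poly (A \<mu>)) ?e = 0"
      using eigenvalue_root_char_poly[OF A] unfolding eigenvalue_def by blast
    then show ?thesis
      using degree_monic_char_poly[OF A, of \<mu>] by (simp add: poly_altdef c_def power_mult_distrib mult.assoc)
  qed
  show ?thesis
  proof (intro exI[of _ N] exI[of _ c] conjI allI impI)
    show "coord_polynomial (2 * d) (c j)" for j by (rule c_poly)
    show "c N \<mu> \<noteq> 0" if "Determinant.det (hankel d \<mu>) \<noteq> 0" for \<mu> using that by (rule c_top)
    show "(\<Sum>j\<le>N. c j \<mu> * f \<mu> w ^ j) = 0" if "(\<mu>, w) \<in> node_relations d" for \<mu> w
      using that by (rule c_root)
  qed
qed

lemma node_relations_node_poly:
  assumes \<mu>: "\<mu> \<in> hankel_regular d" and w: "length w = d" "newton_poly w d = node_poly d \<mu>"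
  shows "(\<mu>, w) \<in> node_relations d"
proof -
  let ?D = "Determinant.det (hankel d \<mu>)"
  have D: "?D \<noteq> 0" using \<mu> by (simp add: hankel_regular_iff)
  have "?D * w ! i ^ d = - (\<Sum>k<d. hankel_numerator d \<mu> k * w ! i ^ k)" if i: "i < d" for i
  proof -
    have "poly (node_poly d \<mu>) (w ! i) = 0"
      unfolding w(2)[symmetric] newton_poly_def poly_prod_list
      using i w(1) by (auto simp: prod_list_zero_iff)
    moreover have "poly (node_poly d \<mu>) x
        = x ^ d + (\<Sum>k<d. hankel_numerator d \<mu> k / ?D * x ^ k)" for x
      by (simp add: node_poly_def poly_monom poly_sum)
    ultimately have "?D * (w ! i ^ d + (\<Sum>k<d. hankel_numerator d \<mu> k / ?D * w ! i ^ k)) = 0" by simp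
    moreover have "?D * (\<Sum>k<d. hankel_numerator d \<mu> k / ?D * w ! i ^ k)
        = (\<Sum>k<d. hankel_numerator d \<mu> k * w ! i ^ k)"
      using D by (simp add: sum_distrib_left)
    ultimately show ?thesis by (simp add: distrib_left eq_neg_iff_add_eq_0)
  qed
  then show ?thesis using w by (simp add: node_relations_def)
qed

lemma prony_solutions_algebraic:
  assumes d: "d \<ge> 1" and U: "U \<subseteq> hankel_regular d"
  shows "algebraic_multivalued_on (2 * d) (2 * d) U (prony_solutions d)"
  unfolding algebraic_multivalued_on_def
proof (intro allI impI)
  fix i assume i: "i < 2 * d"
  obtain N c where c: "\<forall>j\<le>N. coord_polynomial (2 * d) (c j)"
    "\<And>\<mu>. Determinant.det (hankel d \<mu>) \<noteq> 0 \<Longrightarrow> c N \<mu> \<noteq> 0"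
    "\<And>\<mu> w. (\<mu>, w) \<in> node_relations d \<Longrightarrow> (\<Sum>j\<le>N. c j \<mu> * (prony_vector d \<mu> w ! i) ^ j) = 0"
    using acts_on_monomials_algebraic[OF d acts_on_monomials_prony_vector[OF i]] by blast
  have "(\<exists>j\<le>N. c j \<mu> \<noteq> 0) \<and> (\<forall>s\<in>prony_solutions d \<mu>. (\<Sum>j\<le>N. c j \<mu> * (s ! i) ^ j) = 0)"
    if "\<mu> \<in> U" for \<mu>
  proof -
    have \<mu>: "\<mu> \<in> hankel_regular d" using that U by blast
    have "(\<Sum>j\<le>N. c j \<mu> * (s ! i) ^ j) = 0" if s: "s \<in> prony_solutions d \<mu>" for s
    proof -
      obtain w where "length w = d" "newton_poly w d = node_poly d \<mu>" "s = prony_vector d \<mu> w"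
        using s unfolding prony_solutions_eq[OF d \<mu>] prony_vector_def[symmetric] by blast
      then show ?thesis using c(3) node_relations_node_poly[OF \<mu>] by blast
    qed
    then show ?thesis using c(2)[of \<mu>] \<mu> by (auto simp: hankel_regular_iff)
  qed
  then show "\<exists>N c. (\<forall>j\<le>N. coord_polynomial (2 * d) (c j)) \<and>
      (\<forall>\<mu>\<in>U. (\<exists>j\<le>N. c j \<mu> \<noteq> 0) \<and> (\<forall>s\<in>prony_solutions d \<mu>. (\<Sum>j\<le>N. c j \<mu> * (s ! i) ^ j) = 0))"
    using c(1) by blast
qed

theorem theorem4:
  fixes d :: nat and \<mu>\<^sub>0 :: "complex list"
  assumes "d \<ge> 1" and "\<mu>\<^sub>0 \<in> hankel_regular d"
  shows "\<exists>r>0.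
           continuous_multivalued_on (vec_ball (2 * d) \<mu>\<^sub>0 r) (prony_solutions d) \<and>
           algebraic_multivalued_on (2 * d) (2 * d) (vec_ball (2 * d) \<mu>\<^sub>0 r) (prony_solutions d)"
  using hankel_regular_open[OF assms(2)] prony_solutions_continuous[OF assms(1)]
    prony_solutions_algebraic[OF assms(1)] by blast

end
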